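(* (Two Colour Lemma) Let $\phi$ be a positive automorphism of a free group $F$ with finite basis $a_1,\dots,a_m$ satisfying the conditioning properties (1)–(5) listed in the context. There exists a constant $T_0$, depending only on $\phi$, so that for all positive words $U$ and $V$, if $U$ $\phi$-neuters $V^{-1}$ then it does so in at most $T_0$ steps.
   Context: A word is positive if none of its letters are inverses $a_j^{-1}$; $\phi$ is positive if each reduced word $\phi(a_i)$ is positive. A letter $x$ is constant if $\phi(x)=x$. Suppose $U$ and $V$ are positive words and that for some $k>0$ the only negative exponents occurring in (the reduced word) $\phi^k(UV^{-1})$ are on constant letters. Then $U$ is said to $\phi$-neuter $V^{-1}$ in at most $k$ steps. Supports and strata: for a basis letter $x$, $\mathrm{Supp}(x)$ is the set of letters appearing in $\phi^j(x)$ for some $j\ge0$; $\Sigma(x)=\{y\in\mathrm{Supp}(x):\mathrm{Supp}(y)=\mathrm{Supp}(x)\}$; $x$ is exponential if $\Sigma(x)=\Sigma(y)$ for some $y\neq x$. Conditioning properties assumed of $\phi$ (they hold for a suitable positive power of any positive automorphism): (1) each letter $x$ appears in $\phi(x)$; (2) each exponential letter $x$ appears at least 3 times in $\phi(x)$; (3) for all $x$, each $y\in\mathrm{Supp}(x)$ appears in $\phi(x)$; (4) for all $x$ and $j\ge1$ the leftmost and rightmost letters of $\phi^j(x)$ are the same as those of $\phi(x)$; (5) for all $x$, $j\ge1$ and all strata $\Sigma\subseteq\mathrm{Supp}(x)$, the leftmost (resp. rightmost) letter from $\Sigma$ in $\phi^j(x)$ is the same as the leftmost (resp. rightmost) letter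 from $\Sigma$ in $\phi(x)$. *)

theory Defs
  imports Main "HOL-Algebra.Group"
begin

text \<open>
  Words in the basis letters \<open>'a\<close> and their inverses: \<open>(x, True)\<close> is the letter \<open>x\<close> and
  \<open>(x, False)\<close> is \<open>x\<close> with exponent \<open>-1\<close>.  The free group on \<open>'a\<close> is modelled by the reduced
  words, multiplied by concatenation followed by free reduction.
\<close>

type_synonym 'a fword = "('a \<times> bool) list"

definition flip :: "'a \<times> bool \<Rightarrow> 'a \<times> bool" where
  "flip l = (fst l, \<not> snd l)"

definition reduced :: "'a fword \<Rightarrow> bool" where
  "reduced w \<longleftrightarrow> successively (\<lambda>l m. m \<noteq> flip l) w"

fun push :: "'a \<times> bool \<Rightarrow> 'a fword \<Rightarrow> 'a fword" where
  "push l [] = [l]"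
| "push l (m # w) = (if m = flip l then w else l # m # w)"

definition free_reduce :: "'a fword \<Rightarrow> 'a fword" where
  "free_reduce w = foldr push w []"

definition free_group :: "'a fword monoid" where
  "free_group = \<lparr>carrier = {w. reduced w}, mult = (\<lambda>u v. free_reduce (u @ v)), one = []\<rparr>"

definition gen :: "'a \<Rightarrow> 'a fword" where
  "gen x = [(x, True)]"

lemma flip_flip [simp]: "flip (flip l) = l"
  by (simp add: flip_def)

lemma reduced_Nil [simp]: "reduced []"
  by (simp add: reduced_def)

lemma reduced_tl: "reduced (l # w) \<Longrightarrow> reduced w"
  by (cases w) (auto simp: reduced_def)

lemma reduced_push: "reduced w \<Longrightarrow> reduced (push l w)"
  by (cases w) (auto simp: reduced_def successively_Cons)

lemma push_push_flip: "reduced w \<Longrightarrow> push l (push (flip l) w) = w"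
  by (cases w; cases "tl w") (auto simp: reduced_def)

lemma reduced_foldr_push: "reduced w \<Longrightarrow> reduced (foldr push u w)"
  by (induction u) (auto intro: reduced_push)

lemma free_reduce_reduced: "reduced w \<Longrightarrow> free_reduce w = w"
proof (induction w)
  case (Cons l w)
  then have "foldr push w [] = w"
    using reduced_tl[of l w] by (simp add: free_reduce_def)
  with Cons.prems show ?case
    by (cases w) (auto simp: free_reduce_def reduced_def)
qed (simp add: free_reduce_def)

lemma foldr_push_push:
  assumes "reduced w"
  shows "foldr push (push l u) w = push l (foldr push u w)"
  using assms push_push_flip[OF reduced_foldr_push, of w l] by (cases u) auto

lemma foldr_push_free_reduce:
  "reduced w \<Longrightarrow> foldr push (free_reduce u) w = foldr push u w"
  by (induction u) (auto simp: free_reduce_def foldr_push_push)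

lemma foldr_push_inverse:
  "reduced w \<Longrightarrow> foldr push (rev (map flip u)) (foldr push u w) = w"
proof (induction u)
  case (Cons l u)
  then show ?case
    using push_push_flip[of "foldr push u w" "flip l"] reduced_foldr_push[of w u] by simp
qed simp

lemma reduced_rev_flip: "reduced w \<Longrightarrow> reduced (rev (map flip w))"
  unfolding reduced_def successively_rev successively_map
  by (erule successively_mono) auto

lemma free_reduce_append: "free_reduce (u @ v) = foldr push u (free_reduce v)"
  by (simp add: free_reduce_def)

lemma free_reduce_cancel: "reduced w \<Longrightarrow> free_reduce (rev (map flip w) @ w) = []"
  using foldr_push_inverse[of "[]" w] by (simp add: free_reduce_def)

theorem group_free_group: "group (free_group :: 'a fword monoid)"
proof (rule groupI)
  fix u v w :: "'a fword"
  assume "u \<in> carrier free_group" "v \<in> carrier free_group" "w \<in> carrier free_group"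
  then have "reduced w" by (simp add: free_group_def)
  moreover have "reduced (free_reduce (v @ w))"
    by (simp add: free_reduce_def reduced_foldr_push del: foldr_append)
  ultimately show "u \<otimes>\<^bsub>free_group\<^esub> v \<otimes>\<^bsub>free_group\<^esub> w = u \<otimes>\<^bsub>free_group\<^esub> (v \<otimes>\<^bsub>free_group\<^esub> w)"
    using foldr_push_free_reduce[of w "u @ v"] foldr_push_free_reduce[of w v]
    by (simp add: free_group_def free_reduce_append[of _ w] free_reduce_append[of _ "free_reduce _"]
        free_reduce_append[of _ "foldr _ _ _"] free_reduce_reduced)
next
  fix u :: "'a fword"
  assume "u \<in> carrier free_group"
  then show "\<exists>v\<in>carrier free_group. v \<otimes>\<^bsub>free_group\<^esub> u = \<one>\<^bsub>free_group\<^esub>"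
    by (intro bexI[of _ "rev (map flip u)"])
      (simp_all add: free_group_def free_reduce_cancel reduced_rev_flip)
qed (auto simp: free_group_def free_reduce_def free_reduce_reduced[unfolded free_reduce_def]
      reduced_foldr_push)

lemma inv_free_group: "reduced w \<Longrightarrow> inv\<^bsub>free_group\<^esub> w = rev (map flip w)"
  by (rule group.inv_equality[OF group_free_group])
    (simp_all add: free_group_def free_reduce_cancel reduced_rev_flip)

definition positive_word :: "'a fword \<Rightarrow> bool" where
  "positive_word w \<longleftrightarrow> (\<forall>l\<in>set w. snd l)"

definition positive_endo :: "('a fword \<Rightarrow> 'a fword) \<Rightarrow> bool" where
  "positive_endo \<phi> \<longleftrightarrow> (\<forall>x. positive_word (\<phi> (gen x)))"

definition constant_letter :: "('a fword \<Rightarrow> 'a fword) \<Rightarrow> 'a \<Rightarrow> bool" where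
  "constant_letter \<phi> x \<longleftrightarrow> \<phi> (gen x) = gen x"

text \<open>\<open>neuters_within \<phi> U V k\<close>: the word \<open>U\<close> \<open>\<phi>\<close>-neuters the inverse of \<open>V\<close> in at most \<open>k\<close> steps.\<close>

definition neuters_within :: "('a fword \<Rightarrow> 'a fword) \<Rightarrow> 'a fword \<Rightarrow> 'a fword \<Rightarrow> nat \<Rightarrow> bool" where
  "neuters_within \<phi> U V k \<longleftrightarrow> positive_word U \<and> positive_word V \<and> k > 0 \<and>
     (\<forall>x. (x, False) \<in> set ((\<phi> ^^ k) (U \<otimes>\<^bsub>free_group\<^esub> inv\<^bsub>free_group\<^esub> V)) \<longrightarrow> constant_letter \<phi> x)"

definition neuters :: "('a fword \<Rightarrow> 'a fword) \<Rightarrow> 'a fword \<Rightarrow> 'a fword \<Rightarrow> bool" where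
  "neuters \<phi> U V \<longleftrightarrow> (\<exists>k. neuters_within \<phi> U V k)"

definition letters :: "'a fword \<Rightarrow> 'a list" where
  "letters w = map fst w"

definition Supp :: "('a fword \<Rightarrow> 'a fword) \<Rightarrow> 'a \<Rightarrow> 'a set" where
  "Supp \<phi> x = {y. \<exists>j. y \<in> set (letters ((\<phi> ^^ j) (gen x)))}"

definition stratum :: "('a fword \<Rightarrow> 'a fword) \<Rightarrow> 'a \<Rightarrow> 'a set" where
  "stratum \<phi> x = {y \<in> Supp \<phi> x. Supp \<phi> y = Supp \<phi> x}"

definition exponential :: "('a fword \<Rightarrow> 'a fword) \<Rightarrow> 'a \<Rightarrow> bool" where
  "exponential \<phi> x \<longleftrightarrow> (\<exists>y. y \<noteq> x \<and> stratum \<phi> x = stratum \<phi> y)"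

definition leftmost_in :: "'a set \<Rightarrow> 'a fword \<Rightarrow> 'a option" where
  "leftmost_in S w = find (\<lambda>y. y \<in> S) (letters w)"

definition rightmost_in :: "'a set \<Rightarrow> 'a fword \<Rightarrow> 'a option" where
  "rightmost_in S w = find (\<lambda>y. y \<in> S) (rev (letters w))"

definition conditioned :: "('a fword \<Rightarrow> 'a fword) \<Rightarrow> bool" where
  "conditioned \<phi> \<longleftrightarrow>
     (\<forall>x. x \<in> set (letters (\<phi> (gen x)))) \<and>
     (\<forall>x. exponential \<phi> x \<longrightarrow> count_list (letters (\<phi> (gen x))) x \<ge> 3) \<and>
     (\<forall>x. \<forall>y\<in>Supp \<phi> x. y \<in> set (letters (\<phi> (gen x)))) \<and>
     (\<forall>x. \<forall>j\<ge>1. hd (letters ((\<phi> ^^ j) (gen x))) = hd (letters (\<phi> (gen x))) \<and>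
                last (letters ((\<phi> ^^ j) (gen x))) = last (letters (\<phi> (gen x)))) \<and>
     (\<forall>x. \<forall>j\<ge>1. \<forall>S\<in>range (stratum \<phi>). S \<subseteq> Supp \<phi> x \<longrightarrow>
        leftmost_in S ((\<phi> ^^ j) (gen x)) = leftmost_in S (\<phi> (gen x)) \<and>
        rightmost_in S ((\<phi> ^^ j) (gen x)) = rightmost_in S (\<phi> (gen x)))"

end

theory Submission
  imports Defs "HOL-Library.Sublist"
begin

text \<open>
  Words are read from right to left, so that the cancellation in \<open>U V\<^sup>-\<^sup>1\<close> removes the longest common
  prefix; \<open>U\<close> neuters \<open>V\<close> after \<open>k\<close> steps iff every non-constant letter of \<open>\<phi>\<^sup>k(V)\<close> lies in its
  common prefix with \<open>\<phi>\<^sup>k(U)\<close>. Injectivity of \<open>\<phi>\<close> bounds by a constant \<open>B\<close> the number of letters newly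
  cancelled in each step. By (5), the first and last non-constant letters of the iterates of a
  letter stabilise after \<open>W\<close> steps; once both words start, up to constants, with stabilised letters,
  no non-constant letter is ever cancelled again, so until \<open>V\<close> is neutered a non-constant letter must
  be cancelled in every \<open>W\<close> consecutive steps.

  It remains to bound the death time of a letter \<open>x\<close> with \<open>\<phi>(x) = e x g\<close> and \<open>g\<close> constant. If \<open>e\<close> is
  constant, then the letters accumulating around \<open>x\<close> or around its non-constant predecessor cannot be
  consumed fast enough, unless the predecessor is of the second type. If \<open>e\<close> is not constant, then
  everything in front of \<open>x\<close> must die within a bounded time, since otherwise a quadratic amount of
  letters piles up. Hence the uncancelled part in front of \<open>x\<close> has bounded length, and so has the
  uncancelled part in front of the letter of the other word that is going to cancel \<open>x\<close>. If \<open>x\<close> lived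
  too long, a pair of such parts would recur, and the evolution would be periodic.
\<close>

section \<open>Common prefixes and the rests behind them\<close>

definition apart :: "'a list \<Rightarrow> 'a list \<Rightarrow> bool" where
  "apart X Y \<longleftrightarrow> X = [] \<or> Y = [] \<or> hd X \<noteq> hd Y"

lemma apart_sym: "apart X Y \<Longrightarrow> apart Y X"
  by (auto simp: apart_def)

lemma apart_decomposition:
  obtains p X' Y' where "X = p @ X'" "Y = p @ Y'" "apart X' Y'"
proof -
  have "\<exists>p X' Y'. X = p @ X' \<and> Y = p @ Y' \<and> apart X' Y'"
    unfolding apart_def using longest_common_prefix[of X Y] by blast
  with that show thesis by blast
qed

lemma apart_common_prefix:
  assumes "apart X' Y'" "prefix a (p @ X')" "prefix a (p @ Y')"
  shows "prefix a p"
proof (rule ccontr)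
  assume "\<not> prefix a p"
  with assms(2) obtain z where z: "a = p @ z" "z \<noteq> []"
    by (auto simp: prefix_append)
  with assms(2,3) have "prefix z X'" "prefix z Y'" by auto
  with z(2) assms(1) show False by (cases z) (auto simp: apart_def prefix_def)
qed

text \<open>\<open>f\<close> will be the reversed images of the letters, \<open>B\<close> the number
  of letters that one step can newly cancel, and \<open>W\<close> a time by which the first and last
  non-constant letters of all iterates have stabilised: the letter \<open>y\<close> found then is
  the first (last) non-constant letter of its own image.\<close>

locale word_substitution =
  fixes f :: "'a::finite \<Rightarrow> 'a list" and B W :: nat
  assumes self_occurs: "x \<in> set (f x)"
    and bounded_cancellation:
      "apart X Y \<Longrightarrow> prefix p (concat (map f X)) \<Longrightarrow> prefix p (concat (map f Y)) \<Longrightarrow> length p \<le> B"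
    and first_stable: "f x \<noteq> [x] \<Longrightarrow>
      \<exists>c y r. ((\<lambda>w. concat (map f w)) ^^ W) [x] = c @ y # r \<and> (\<forall>z\<in>set c. f z = [z]) \<and>
        f y \<noteq> [y] \<and> (\<exists>e s. f y = e @ y # s \<and> (\<forall>z\<in>set e. f z = [z]))"
    and last_stable: "f x \<noteq> [x] \<Longrightarrow>
      \<exists>c y r. ((\<lambda>w. concat (map f w)) ^^ W) [x] = r @ y # c \<and> (\<forall>z\<in>set c. f z = [z]) \<and>
        f y \<noteq> [y] \<and> (\<exists>e s. f y = s @ y # e \<and> (\<forall>z\<in>set e. f z = [z]))"
begin

section \<open>Iterates, constant letters and core lengths\<close>

definition iter :: "nat \<Rightarrow> 'a list \<Rightarrow> 'a list" where
  "iter k = (\<lambda>w. concat (map f w)) ^^ k"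

definition const_word :: "'a list \<Rightarrow> bool" where
  "const_word w \<longleftrightarrow> (\<forall>x\<in>set w. f x = [x])"

text \<open>Trailing constants never have to be cancelled, so this measures what must disappear
  before a word is neutered.\<close>

definition core_length :: "'a list \<Rightarrow> nat" where
  "core_length w = length (dropWhile (\<lambda>x. f x = [x]) (rev w))"

definition absorbs :: "'a list \<Rightarrow> 'a list \<Rightarrow> bool" where
  "absorbs U V \<longleftrightarrow> (\<exists>p r. prefix p U \<and> V = p @ r \<and> const_word r)"

definition dead :: "nat \<Rightarrow> 'a list \<Rightarrow> 'a list \<Rightarrow> bool" where
  "dead k U V \<longleftrightarrow> absorbs (iter k U) (iter k V)"

lemma const_word_simps [simp]:
  "const_word []"
  "const_word (x # w) \<longleftrightarrow> f x = [x] \<and> const_word w"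
  "const_word (u @ w) \<longleftrightarrow> const_word u \<and> const_word w"
  by (auto simp: const_word_def)

lemma iter_0 [simp]: "iter 0 w = w"
  by (simp add: iter_def)

lemma iter_Suc: "iter (Suc k) w = concat (map f (iter k w))"
  by (simp add: iter_def)

lemma iter_1: "iter (Suc 0) w = concat (map f w)"
  by (simp add: iter_Suc)

lemma iter_iter: "iter j (iter k w) = iter (j + k) w"
  by (simp add: iter_def funpow_add)

lemma iter_Suc2: "iter (Suc k) w = iter k (concat (map f w))"
  using iter_iter[of k 1 w] by (simp add: iter_1)

lemma iter_Nil [simp]: "iter k [] = []"
  by (induction k) (auto simp: iter_Suc)

lemma iter_append [simp]: "iter k (u @ w) = iter k u @ iter k w"
  by (induction k) (auto simp: iter_Suc)

lemma const_word_image: "const_word w \<Longrightarrow> concat (map f w) = w"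
  by (induction w) auto

lemma iter_const_word [simp]: "const_word w \<Longrightarrow> iter k w = w"
  by (induction k) (auto simp: iter_Suc const_word_image)

lemma prefix_iter: "prefix u w \<Longrightarrow> prefix (iter k u) (iter k w)"
  by (auto simp: prefix_def)

lemma const_word_image_iff: "const_word (concat (map f w)) \<longleftrightarrow> const_word w"
proof
  show "const_word (concat (map f w)) \<Longrightarrow> const_word w"
    using self_occurs by (fastforce simp: const_word_def)
qed (simp add: const_word_image)

lemma const_word_iter_iff [simp]: "const_word (iter k w) \<longleftrightarrow> const_word w"
  by (induction k) (auto simp: iter_Suc const_word_image_iff)

lemma letter_image_nonempty: "f x \<noteq> []"
  using self_occurs[of x] by auto

lemma length_image: "length w \<le> length (concat (map f w))"
proof (induction w)
  case (Cons x w)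
  have "1 \<le> length (f x)" using letter_image_nonempty[of x] by (simp add: Suc_le_eq)
  with Cons show ?case by simp
qed simp

lemma length_nonconstant_image: "f x \<noteq> [x] \<Longrightarrow> 2 \<le> length (f x)"
  using self_occurs[of x] by (cases "f x"; cases "tl (f x)") auto

lemma nonconst_append_eq:
  assumes "c @ x # u = d @ y # w" "const_word c" "const_word d" "f x \<noteq> [x]" "f y \<noteq> [y]"
  shows "c = d" "x = y" "u = w"
proof -
  have "takeWhile (\<lambda>x. f x = [x]) (c @ x # u) = c" "takeWhile (\<lambda>x. f x = [x]) (d @ y # w) = d"
    using assms(2-5) by (simp_all add: const_word_def takeWhile_append2)
  with assms(1) have "c = d" by simp
  with assms(1) show "c = d" "x = y" "u = w" by auto
qed

lemma first_nonconst:
  assumes "\<not> const_word w" obtains c x r where "w = c @ x # r" "const_word c" "f x \<noteq> [x]"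
  using assms split_list_first_prop[of w "\<lambda>x. f x \<noteq> [x]"] by (auto simp: const_word_def)

lemma last_nonconst:
  assumes "\<not> const_word w" obtains c x r where "w = r @ x # c" "const_word c" "f x \<noteq> [x]"
  using assms split_list_last_prop[of w "\<lambda>x. f x \<noteq> [x]"] by (auto simp: const_word_def)

text \<open>Locates the cut between a matched part \<open>r\<close> and a constant rest
  \<open>s\<close> inside \<open>b\<close>, so that all of \<open>a\<close> is matched, trailing
  constants included. This sharpens absorption to a prefix relation.\<close>

lemma const_word_suffix_of_nonconst:
  assumes "r @ s = a @ b" "const_word s" "\<not> const_word b"
  shows "\<exists>z. r = a @ z \<and> b = z @ s"
  using assms by (auto simp: append_eq_append_conv2)

lemma core_length_append:
  "core_length (u @ w) = (if const_word w then core_length u else length u + core_length w)"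
proof (cases "const_word w")
  case True
  then have "dropWhile (\<lambda>x. f x = [x]) (rev w @ rev u) = dropWhile (\<lambda>x. f x = [x]) (rev u)"
    by (intro dropWhile_append2) (auto simp: const_word_def)
  with True show ?thesis by (simp add: core_length_def)
next
  case False
  then obtain x where "x \<in> set (rev w)" "f x \<noteq> [x]" by (auto simp: const_word_def)
  then show ?thesis using False by (simp add: core_length_def dropWhile_append1)
qed

lemma core_length_0 [simp]: "core_length w = 0 \<longleftrightarrow> const_word w"
  by (auto simp: core_length_def const_word_def)

lemma core_length_append_le: "core_length (u @ w) \<le> length u + core_length w"
  using length_dropWhile_le[of "\<lambda>x. f x = [x]" "rev u"]
  by (auto simp: core_length_append) (simp add: core_length_def)

lemma core_length_suffix_le: "core_length w \<le> core_length (u @ w)"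
  by (cases "const_word w") (use core_length_0[of w] in \<open>auto simp: core_length_append simp del: core_length_0\<close>)

lemma core_length_singleton: "f x \<noteq> [x] \<Longrightarrow> core_length [x] = 1"
  by (simp add: core_length_def)

text \<open>The last non-constant letter occurs in its own image, and no letter before it has an
  empty image.\<close>

lemma core_length_image: "core_length w \<le> core_length (concat (map f w))"
proof (induction w rule: rev_induct)
  case (snoc x w)
  show ?case
  proof (cases "f x = [x]")
    case True
    then show ?thesis using snoc by (simp add: core_length_append)
  next
    case False
    then have "\<not> const_word (f x)" using self_occurs[of x] by (auto simp: const_word_def)
    then have "core_length (f x) > 0" by (metis core_length_0 neq0_conv)
    then show ?thesis using False \<open>\<not> const_word (f x)\<close> length_image[of w]
      by (simp add: core_length_append core_length_singleton)
  qed
qed simp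

section \<open>Absorption\<close>

lemma absorbs_const_word: "const_word V \<Longrightarrow> absorbs U V"
  unfolding absorbs_def by (rule exI[of _ "[]"]) auto

lemma absorbs_prefix: "prefix V U \<Longrightarrow> absorbs U V"
  unfolding absorbs_def by (rule exI[of _ V]) auto

lemma absorbs_cancel: "absorbs (p @ U) (p @ V) \<longleftrightarrow> absorbs U V"
proof
  assume "absorbs (p @ U) (p @ V)"
  then obtain q r where qr: "prefix q (p @ U)" "p @ V = q @ r" "const_word r" by (auto simp: absorbs_def)
  from qr(2) consider z where "p = q @ z" "r = z @ V" | z where "q = p @ z" "V = z @ r"
    by (auto simp: append_eq_append_conv2)
  then show "absorbs U V"
  proof cases
    case 1
    then show ?thesis using qr(3) by (auto intro: absorbs_const_word)
  next
    case 2
    then show ?thesis using qr by (auto simp: absorbs_def)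
  qed
next
  assume "absorbs U V"
  then obtain q r where "prefix q U" "V = q @ r" "const_word r" by (auto simp: absorbs_def)
  then show "absorbs (p @ U) (p @ V)" unfolding absorbs_def
    by (intro exI[of _ "p @ q"] exI[of _ r]) auto
qed

lemma absorbs_left: "absorbs U (V @ Z) \<Longrightarrow> absorbs U V"
proof -
  assume "absorbs U (V @ Z)"
  then obtain p r where pr: "prefix p U" "V @ Z = p @ r" "const_word r" by (auto simp: absorbs_def)
  from pr(2) consider z where "V = p @ z" "r = z @ Z" | z where "p = V @ z"
    by (auto simp: append_eq_append_conv2)
  then show "absorbs U V"
  proof cases
    case 1
    then show ?thesis using pr by (auto simp: absorbs_def)
  next
    case 2
    then show ?thesis using pr(1) by (auto intro!: absorbs_prefix dest: append_prefixD)
  qed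
qed

lemma absorbs_append_const_word: "absorbs U V \<Longrightarrow> const_word c \<Longrightarrow> absorbs U (V @ c)"
  by (fastforce simp: absorbs_def)

lemma absorbs_mono: "absorbs U V \<Longrightarrow> prefix U U' \<Longrightarrow> absorbs U' V"
  by (metis absorbs_def prefix_order.trans)

lemma absorbs_drop_const_word: "absorbs (U @ c) V \<Longrightarrow> const_word c \<Longrightarrow> absorbs U V"
proof -
  assume a: "absorbs (U @ c) V" and c: "const_word c"
  then obtain p r where pr: "prefix p (U @ c)" "V = p @ r" "const_word r" by (auto simp: absorbs_def)
  then consider "prefix p U" | z where "p = U @ z" "prefix z c"
    by (auto simp: prefix_append)
  then show "absorbs U V"
  proof cases
    case 1
    then show ?thesis using pr by (auto simp: absorbs_def)
  next
    case 2
    then show ?thesis using pr c unfolding absorbs_def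
      by (intro exI[of _ U] exI[of _ "z @ r"]) (auto simp: prefix_def)
  qed
qed

lemma absorbs_image: "absorbs U V \<Longrightarrow> absorbs (concat (map f U)) (concat (map f V))"
  unfolding absorbs_def by (fastforce simp: prefix_def const_word_image)

lemma absorbs_apart: "absorbs U V \<Longrightarrow> apart U V \<Longrightarrow> const_word V"
  unfolding absorbs_def apart_def by (metis append_Nil hd_append2 prefix_Nil prefix_def)

text \<open>Truncation can exchange the roles: if \<open>X\<close> stops inside the matched part, it
  is a prefix of \<open>V\<close> and hence comparable with \<open>Y\<close>.\<close>

lemma absorbs_either:
  assumes "absorbs U V" "prefix X U" "prefix Y V"
  shows "absorbs X Y \<or> absorbs Y X"
proof -
  from assms(1) obtain p r where pr: "prefix p U" "V = p @ r" "const_word r" by (auto simp: absorbs_def)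
  show ?thesis
  proof (cases "prefix p X")
    case True
    have "absorbs X V" using True pr by (auto simp: absorbs_def)
    then show ?thesis using assms(3) by (auto simp: prefix_def dest: absorbs_left)
  next
    case False
    then have "prefix X p" using assms(2) pr(1) prefix_same_cases by blast
    then have "prefix X V" using pr by (auto simp: prefix_def)
    then have "prefix X Y \<or> prefix Y X" using assms(3) prefix_same_cases by blast
    then show ?thesis by (auto intro: absorbs_prefix)
  qed
qed

section \<open>Death in time and under truncation\<close>

lemma dead_Suc: "dead k U V \<Longrightarrow> dead (Suc k) U V"
  unfolding dead_def iter_Suc by (rule absorbs_image)

lemma dead_mono: "dead k U V \<Longrightarrow> k \<le> l \<Longrightarrow> dead l U V"
  by (induction l) (auto simp: le_Suc_eq intro: dead_Suc)

lemma dead_iter: "dead j (iter k U) (iter k V) \<longleftrightarrow> dead (j + k) U V"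
  by (simp add: dead_def iter_iter)

lemma dead_cancel: "dead k (p @ U) (p @ V) \<longleftrightarrow> dead k U V"
  by (simp add: dead_def absorbs_cancel)

lemma dead_left: "dead k U (V @ Z) \<Longrightarrow> dead k U V"
  by (auto simp: dead_def intro: absorbs_left)

lemma dead_append_const_word: "dead k U V \<Longrightarrow> const_word c \<Longrightarrow> dead k U (V @ c)"
  by (auto simp: dead_def intro: absorbs_append_const_word)

lemma dead_append_mono: "dead k U V \<Longrightarrow> prefix U U' \<Longrightarrow> dead k U' V"
  by (auto simp: dead_def intro: absorbs_mono prefix_iter)

lemma dead_drop_const_word: "dead k (U @ c) V \<Longrightarrow> const_word c \<Longrightarrow> dead k U V"
  by (auto simp: dead_def intro: absorbs_drop_const_word)

lemma dead_either:
  "dead k U V \<Longrightarrow> prefix X U \<Longrightarrow> prefix Y V \<Longrightarrow> dead k X Y \<or> dead k Y X"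
  unfolding dead_def by (rule absorbs_either) (auto intro: prefix_iter)

lemma dead_0: "dead 0 U V \<longleftrightarrow> absorbs U V"
  by (simp add: dead_def)

lemma dead_const_word: "const_word V \<Longrightarrow> dead k U V"
  by (simp add: dead_def absorbs_const_word)

lemma dead_prefix_left: "dead k U V \<Longrightarrow> prefix V' V \<Longrightarrow> dead k U V'"
  by (auto simp: prefix_def dest: dead_left)

lemma dead_later: "dead n U V \<Longrightarrow> dead n (iter k U) (iter k V)"
  by (simp add: dead_iter dead_mono)

text \<open>Each step cancels at most \<open>B\<close> new letters and \<open>f\<close> never
  shortens a core, so the initial core must be used up in \<open>n\<close> portions of at most
  \<open>B\<close> letters.\<close>

lemma core_length_dead: "apart U V \<Longrightarrow> dead n U V \<Longrightarrow> core_length V \<le> n * B"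
proof (induction n arbitrary: U V)
  case 0
  then show ?case by (auto simp: dead_0 dest: absorbs_apart)
next
  case (Suc n)
  obtain p U1 V1 where d: "concat (map f U) = p @ U1" "concat (map f V) = p @ V1" "apart U1 V1"
    by (rule apart_decomposition)
  have "dead n (p @ U1) (p @ V1)"
    using Suc.prems(2) by (simp add: dead_def iter_Suc2 d flip: iter_append)
  then have "core_length V1 \<le> n * B" using Suc.IH d(3) by (simp add: dead_cancel)
  moreover have "length p \<le> B" by (rule bounded_cancellation[OF Suc.prems(1)]) (auto simp: d)
  moreover have "core_length V \<le> length p + core_length V1"
    using core_length_image[of V] core_length_append_le[of p V1] by (simp add: d)
  ultimately show ?case by simp
qed

text \<open>The common prefix with \<open>U\<close> stops inside \<open>A\<close>, so
  \<open>Z\<close> lies wholly in the uncancelled part.\<close>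

lemma core_length_after_survivor:
  assumes "\<not> absorbs U A" "dead n U (A @ Z)"
  shows "core_length Z \<le> n * B"
proof -
  obtain p U1 V1 where d: "U = p @ U1" "A @ Z = p @ V1" "apart U1 V1"
    by (rule apart_decomposition)
  have "\<not> prefix A p" using assms(1) d(1) by (auto intro: absorbs_prefix prefix_prefix)
  with d(2) obtain b where b: "A = p @ b" "V1 = b @ Z"
    by (auto simp: append_eq_append_conv2)
  have "dead n U1 V1" using assms(2) d by (simp add: dead_cancel)
  then have "core_length V1 \<le> n * B" using d(3) core_length_dead by blast
  then show ?thesis using core_length_suffix_le[of Z b] b by simp
qed

section \<open>Words that start with a stabilised letter\<close>

abbreviation rep :: "nat \<Rightarrow> 'a list \<Rightarrow> 'a list" where
  "rep n e \<equiv> concat (replicate n e)"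

lemma rep_commute: "rep n e @ e = e @ rep n e"
  by (induction n) auto

lemma const_word_rep: "const_word e \<Longrightarrow> const_word (rep n e)"
  by (induction n) auto

lemma length_rep: "length (rep n e) = n * length e"
  by (induction n) auto

lemma iter_first_fixed:
  assumes "const_word c" "const_word e" "f x = e @ x # s"
  shows "\<exists>Z'. iter n (c @ x # Z) = c @ rep n e @ x # Z'"
proof (induction n)
  case (Suc n)
  then obtain Z' where "iter n (c @ x # Z) = c @ rep n e @ x # Z'" by blast
  moreover have "const_word (rep n e)" using assms(2) by (rule const_word_rep)
  ultimately have "iter (Suc n) (c @ x # Z) = c @ (rep n e @ e) @ x # (s @ concat (map f Z'))"
    using assms by (simp add: iter_Suc const_word_image)
  then show ?case by (simp add: rep_commute)
qed simp

text \<open>Both words carry the same constant padding before the first non-constant letter, so matching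
  these letters at time \<open>n\<close> means that they matched at the start.\<close>

lemma not_dead_first_fixed:
  assumes "apart U V" "V = c @ x # V1" "const_word c" "f x \<noteq> [x]" "f x = e @ x # s" "const_word e"
    and U: "const_word U \<or> (\<exists>d y U1 e' s'. U = d @ y # U1 \<and> const_word d \<and> f y \<noteq> [y] \<and> f y = e' @ y # s' \<and> const_word e')"
  shows "\<not> dead n U V"
proof
  assume "dead n U V"
  then obtain p r where pr: "prefix p (iter n U)" "iter n V = p @ r" "const_word r"
    by (auto simp: dead_def absorbs_def)
  obtain V2 where V2: "iter n V = (c @ rep n e) @ x # V2"
    using iter_first_fixed[OF assms(3,6,5)] assms(2) by fastforce
  have ce: "const_word (c @ rep n e)" using assms(3,6) const_word_rep by simp
  have "\<not> const_word (x # V2)" using assms(4) by simp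
  then obtain z where z: "p = (c @ rep n e) @ z" "x # V2 = z @ r"
    using const_word_suffix_of_nonconst[of p r "c @ rep n e" "x # V2"] pr V2 by metis
  with pr(3) \<open>\<not> const_word (x # V2)\<close> obtain z' where "z = x # z'" by (cases z) auto
  with z pr(1) obtain U2 where U2: "iter n U = (c @ rep n e) @ x # U2"
    by (auto simp: prefix_def)
  from U show False
  proof
    assume "const_word U"
    then show False using U2 assms(4) by auto
  next
    assume "\<exists>d y U1 e' s'. U = d @ y # U1 \<and> const_word d \<and> f y \<noteq> [y] \<and> f y = e' @ y # s' \<and> const_word e'"
    then obtain d y U1 e' s' where d: "U = d @ y # U1" "const_word d" "f y \<noteq> [y]" "f y = e' @ y # s'" "const_word e'"
      by blast
    obtain U3 where U3: "iter n U = (d @ rep n e') @ y # U3"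
      using iter_first_fixed[OF d(2,5,4)] d(1) by fastforce
    have de: "const_word (d @ rep n e')" using d const_word_rep by simp
    note eq = nonconst_append_eq[OF trans[OF U2[symmetric] U3] ce de assms(4) d(3)]
    have "e @ x # s = e' @ x # s'" using assms(5) d(4) eq(2) by simp
    then have "e = e'" using nonconst_append_eq(1)[of e x s e' x s'] assms(4,6) d(5) by blast
    with eq have "c = d" by simp
    with eq d(1) assms(1,2) show False by (cases c) (auto simp: apart_def)
  qed
qed

lemma iter_first_nonconst:
  assumes "\<not> const_word V"
  obtains c x V1 e s where "iter W V = c @ x # V1" "const_word c" "f x \<noteq> [x]" "f x = e @ x # s" "const_word e"
proof -
  obtain c x V1 where V: "V = c @ x # V1" "const_word c" "f x \<noteq> [x]"
    using first_nonconst[OF assms] by blast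
  obtain c' y r e s where y: "iter W [x] = c' @ y # r" "const_word c'" "f y \<noteq> [y]" "f y = e @ y # s" "const_word e"
    using first_stable[OF V(3)] unfolding iter_def const_word_def by blast
  have "iter W V = iter W (c @ [x] @ V1)" using V(1) by simp
  also have "\<dots> = (c @ c') @ y # (r @ iter W V1)"
    using V(2) y(1) by (simp only: iter_append iter_const_word) simp
  finally show thesis using V(2) y that[of "c @ c'" y] by simp
qed

lemma iter_last_nonconst:
  assumes "f x \<noteq> [x]"
  obtains c y r e s where "iter W [x] = r @ y # c" "const_word c" "f y \<noteq> [y]" "f y = s @ y # e" "const_word e"
  using last_stable[OF assms] unfolding iter_def const_word_def by blast

text \<open>After \<open>W\<close> steps both words start, up to constants, with stabilised letters,
  unless the first is constant. If their common prefix were constant, the same would hold for the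
  rests, and \<open>not_dead_first_fixed\<close> would keep the second one alive forever.\<close>

lemma nonconst_matched:
  assumes "dead n U V" "\<not> const_word V"
  obtains c x U1 V1 where "iter W U = c @ x # U1" "iter W V = c @ x # V1" "const_word c" "f x \<noteq> [x]"
proof -
  obtain p U' V' where d: "iter W U = p @ U'" "iter W V = p @ V'" "apart U' V'"
    by (rule apart_decomposition)
  have "\<not> const_word p"
  proof
    assume p: "const_word p"
    have "dead n U' V'" using dead_later[OF assms(1), of W] by (simp add: d dead_cancel)
    obtain c x V1 e s where V: "iter W V = c @ x # V1" "const_word c" "f x \<noteq> [x]" "f x = e @ x # s" "const_word e"
      using iter_first_nonconst[OF assms(2)] by blast
    \<comment> \<open>The constant \<open>p\<close> cannot contain the first non-constant letter,
      which is therefore also the first one of the rest.\<close>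
    have first: "\<exists>c'. c = p @ c' \<and> X' = c' @ y # X1"
      if "p @ X' = c @ y # X1" "const_word c" "f y \<noteq> [y]" for X' c y X1
      using that p by (fastforce simp: append_eq_append_conv2 append_eq_Cons_conv)
    obtain c' where c': "c = p @ c'" "V' = c' @ x # V1" using first[of V' c x V1] V d by auto
    have "const_word U' \<or> (\<exists>d y U1 e' s'. U' = d @ y # U1 \<and> const_word d \<and> f y \<noteq> [y] \<and> f y = e' @ y # s' \<and> const_word e')"
    proof (cases "const_word U")
      case True
      then have "const_word (p @ U')" using d(1) by (metis iter_const_word)
      then show ?thesis by simp
    next
      case False
      obtain c2 y U1 e' s' where U: "iter W U = c2 @ y # U1" "const_word c2" "f y \<noteq> [y]"
        "f y = e' @ y # s'" "const_word e'"
        using iter_first_nonconst[OF False] by blast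
      then obtain c3 where "c2 = p @ c3" "U' = c3 @ y # U1" using first[of U' c2 y U1] d by auto
      then show ?thesis using U const_word_simps(3)[of p c3] by metis
    qed
    then have "\<not> dead n U' V'"
      using not_dead_first_fixed[OF d(3) c'(2), of e s n] V c' by auto
    with \<open>dead n U' V'\<close> show False by blast
  qed
  then obtain c x r where "p = c @ x # r" "const_word c" "f x \<noteq> [x]" using first_nonconst by blast
  then show thesis using that d by auto
qed

section \<open>Letters of linear growth\<close>

lemma iter_linear:
  assumes "f x = e @ x # g" "const_word e" "const_word g"
  shows "iter n [x] = rep n e @ x # rep n g"
proof (induction n)
  case (Suc n)
  then have "iter (Suc n) [x] = (rep n e @ e) @ x # rep (Suc n) g"
    using assms const_word_rep[of e n] const_word_rep[of g n] by (simp add: iter_Suc const_word_image)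
  then show ?case by (simp only: rep_commute) simp
qed simp

text \<open>Only constants \<open>r\<close> are left of \<open>A\<close>, so \<open>x\<close> is the
  only non-constant letter of the rest and of all its iterates. The letter that
  \<open>nonconst_matched\<close> finds cancelled after \<open>W\<close> steps must be this
  \<open>x\<close>.\<close>

lemma linear_dead_0:
  assumes x: "f x \<noteq> [x]" "f x = e @ x # g" "const_word e" "const_word g"
    and "absorbs U A" "dead n U (A @ [x])"
  shows "dead W U (A @ [x])"
proof -
  from assms(5) obtain p r U' where pr: "U = p @ U'" "A = p @ r" "const_word r"
    by (auto simp: absorbs_def prefix_def)
  have "dead n U' (r @ [x])" using assms(6) pr by (simp add: dead_cancel)
  moreover have "\<not> const_word (r @ [x])" using x by simp
  ultimately obtain c y U1 V1 where c: "iter W U' = c @ y # U1" "iter W (r @ [x]) = c @ y # V1"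
    "const_word c" "f y \<noteq> [y]"
    by (rule nonconst_matched)
  have "(r @ rep W e) @ x # rep W g = c @ y # V1"
    using c(2) pr(3) by (simp add: iter_linear[OF x(2-4)])
  note eq = nonconst_append_eq[OF this _ c(3) x(1) c(4)]
  have "const_word (r @ rep W e)" using pr(3) x(3) by (simp add: const_word_rep)
  note eq = eq[OF this]
  have "absorbs (iter W U') (iter W (r @ [x]))"
    unfolding absorbs_def c(1,2) using x(4) const_word_rep[of g W] eq
    by (intro exI[of _ "c @ [y]"] exI[of _ V1]) auto
  then show ?thesis using pr by (simp add: dead_def absorbs_cancel)
qed

text \<open>Restart at time \<open>t\<close>: the copies of \<open>e\<close> in front of
  \<open>x\<close> join the absorbed part, and the copies of \<open>g\<close> behind it are appended
  afterwards.\<close>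

lemma linear_dead:
  assumes x: "f x \<noteq> [x]" "f x = e @ x # g" "const_word e" "const_word g"
    and "dead t U A" "dead n U (A @ [x])"
  shows "dead (W + t) U (A @ [x])"
proof -
  have g: "const_word (rep t g)" and e: "const_word (rep t e)" using x by (simp_all add: const_word_rep)
  have eq: "iter t (A @ [x]) = ((iter t A @ rep t e) @ [x]) @ rep t g"
    by (simp add: iter_linear[OF x(2-4)])
  have "dead W (iter t U) ((iter t A @ rep t e) @ [x])"
  proof (rule linear_dead_0[OF x])
    show "absorbs (iter t U) (iter t A @ rep t e)"
      using assms(5) e by (simp add: dead_def absorbs_append_const_word)
    have "dead n (iter t U) (iter t (A @ [x]))" using assms(6) by (rule dead_later)
    then show "dead n (iter t U) ((iter t A @ rep t e) @ [x])" unfolding eq by (rule dead_left)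
  qed
  then have "dead W (iter t U) (iter t (A @ [x]))" unfolding eq using g by (rule dead_append_const_word)
  then show ?thesis by (simp only: dead_iter)
qed

text \<open>One \<open>W\<close> is for stabilising the predecessor of the letter, two are for
  applications of \<open>linear_dead\<close>; \<open>(W + 1) * B\<close> is the time for which
  constants can accumulate.\<close>

definition linear_bound :: nat where
  "linear_bound = 3 * W + (W + 1) * B"

lemma first_death:
  assumes "dead n U V"
  obtains t where "dead t U V" "t \<le> n" "\<And>s. s < t \<Longrightarrow> \<not> dead s U V"
  using that[of "LEAST t. dead t U V"] assms
  by (metis (mono_tags, lifting) LeastI Least_le not_less_Least)

text \<open>While \<open>A\<close> survives, each step adds a copy of \<open>e\<close> in front of
  \<open>x\<close>. Just before \<open>A\<close> dies, all these letters stand behind a survivor but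
  are cancelled within \<open>W + 1\<close> steps, so there are at most \<open>(W + 1) * B\<close>
  of them.\<close>

lemma linear_left_growing_dead:
  assumes x: "f x \<noteq> [x]" "f x = e @ x # g" "const_word e" "const_word g" "e \<noteq> []"
    and "dead n U (A @ [x])"
  shows "dead (W + (W + 1) * B) U (A @ [x])"
proof -
  obtain t where t: "dead t U A" "\<And>s. s < t \<Longrightarrow> \<not> dead s U A"
    using first_death dead_left[OF assms(6)] by metis
  have d: "dead (W + t) U (A @ [x])" by (rule linear_dead[OF x(1-4) t(1) assms(6)])
  have "t \<le> (W + 1) * B"
  proof (cases t)
    case (Suc s)
    have "core_length (iter s [x]) \<le> (W + 1) * B"
    proof (rule core_length_after_survivor)
      show "\<not> absorbs (iter s U) (iter s A)" using t(2)[of s] Suc by (simp add: dead_def)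
      show "dead (W + 1) (iter s U) (iter s A @ iter s [x])"
        using d Suc by (simp add: dead_iter flip: iter_append)
    qed
    moreover have "core_length (iter s [x]) = s * length e + 1"
      using x const_word_rep[of g s] core_length_append[of "[x]" "rep s g"]
      by (simp add: iter_linear[OF x(2-4)] core_length_append length_rep core_length_singleton)
    moreover have "s \<le> s * length e" using x(5) by (cases e) auto
    ultimately show ?thesis using Suc by linarith
  qed simp
  with d show ?thesis by (auto intro: dead_mono)
qed

text \<open>The only obstruction to bounding the death of a letter of linear growth is a preceding letter
  \<open>z\<close> that grows to the left by non-constant letters.\<close>

lemma linear_dead_or_reduce:
  assumes x: "f x \<noteq> [x]" "f x = e @ x # g" "const_word e" "const_word g"
    and d: "dead n U (A @ [x])"
  shows "dead linear_bound U (A @ [x]) \<or>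
    (\<exists>Q z e' g'. f z = e' @ z # g' \<and> \<not> const_word e' \<and> const_word g' \<and> prefix (Q @ [z]) (iter W A) \<and>
      (\<forall>t. dead t (iter W U) (Q @ [z]) \<longrightarrow> dead (t + 2 * W) U (A @ [x])))"
proof (cases "const_word A")
  case True
  have "dead (W + 0) U (A @ [x])" by (rule linear_dead[OF x dead_const_word[OF True] d])
  then show ?thesis by (auto simp: linear_bound_def intro: dead_mono)
next
  case False
  then obtain A' y c where A: "A = A' @ y # c" "const_word c" "f y \<noteq> [y]" using last_nonconst by blast
  obtain r z c' e' g' where z: "iter W [y] = r @ z # c'" "const_word c'" "f z \<noteq> [z]"
    "f z = e' @ z # g'" "const_word g'"
    using iter_last_nonconst[OF A(3)] by metis
  define Q where "Q = iter W A' @ r"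
  have WA: "iter W A = Q @ [z] @ c' @ c"
  proof -
    have "iter W A = iter W (A' @ [y] @ c)" using A(1) by simp
    then show ?thesis using A(2) z(1) by (simp only: iter_append iter_const_word) (simp add: Q_def)
  qed
  have cc: "const_word (c' @ c)" using A z by simp
  \<comment> \<open>One \<open>W\<close> is the delay until \<open>z\<close> appears, the other is
    the cost of \<open>linear_dead\<close> for \<open>x\<close>.\<close>
  have transfer: "dead (t + 2 * W) U (A @ [x])" if "dead t (iter W U) (Q @ [z])" for t
  proof -
    have "dead t (iter W U) (iter W A)"
      using dead_append_const_word[OF that cc] WA by simp
    then have "dead (t + W) U A" by (simp add: dead_iter)
    then have "dead (W + (t + W)) U (A @ [x])" using linear_dead[OF x _ d] by blast
    then show ?thesis by (rule dead_mono) simp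
  qed
  have dz: "dead n (iter W U) (Q @ [z])"
  proof -
    have "dead n (iter W U) (iter W A)" using dead_left[OF d] by (rule dead_later)
    then have "dead n (iter W U) ((Q @ [z]) @ c' @ c)" by (simp add: WA)
    then show ?thesis by (rule dead_left)
  qed
  show ?thesis
  proof (cases "const_word e'")
    case False
    have "prefix (Q @ [z]) (iter W A)" by (simp add: WA)
    with False show ?thesis using transfer z(4,5) by blast
  next
    case True
    note z' = z(3,4) True z(5)
    have "dead linear_bound U (A @ [x])"
    proof (cases "e' = []")
      case False
      have "dead (W + (W + 1) * B) (iter W U) (Q @ [z])"
        by (rule linear_left_growing_dead[OF z' False dz])
      from transfer[OF this] show ?thesis by (simp add: linear_bound_def algebra_simps)
    next
      case e': True
      then have g': "g' \<noteq> []" using z(3,4) by auto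
      obtain t where t: "dead t (iter W U) (Q @ [z])"
        "\<And>s. s < t \<Longrightarrow> \<not> dead s (iter W U) (Q @ [z])"
        using first_death[OF dz] by metis
      have "t \<le> (W + 1) * B"
      proof (cases t)
        case (Suc s)
        \<comment> \<open>Since \<open>e'\<close> is empty, the copies of \<open>g'\<close> pile up
          behind \<open>z\<close>. They are constant, but count in the core of \<open>Z\<close>
          because \<open>x\<close> follows them.\<close>
        define Z where "Z = rep s g' @ (c' @ c) @ iter (s + W) [x]"
        have gs: "const_word (rep s g')" using z(5) by (rule const_word_rep)
        have eq: "iter (s + W) (A @ [x]) = (iter s Q @ [z]) @ Z"
        proof -
          have "iter (s + W) A = iter s (Q @ [z] @ c' @ c)" by (simp only: WA flip: iter_iter)
          also have "\<dots> = (iter s Q @ [z]) @ rep s g' @ c' @ c"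
            using iter_linear[OF z(4) True z(5), of s] cc e' by (simp only: iter_append iter_const_word) simp
          finally show ?thesis by (simp add: Z_def)
        qed
        have Z: "core_length Z \<le> (W + 1) * B"
        proof (rule core_length_after_survivor)
          show "\<not> absorbs (iter s (iter W U)) (iter s Q @ [z])"
          proof
            assume "absorbs (iter s (iter W U)) (iter s Q @ [z])"
            then have "absorbs (iter s (iter W U)) ((iter s Q @ [z]) @ rep s g')"
              using gs by (rule absorbs_append_const_word)
            then have "dead s (iter W U) (Q @ [z])"
              using iter_linear[OF z(4) True z(5), of s] e' by (simp add: dead_def)
            with t(2)[of s] Suc show False by simp
          qed
          have "dead (t + 2 * W) U (A @ [x])" by (rule transfer[OF t(1)])
          then have "dead (W + 1) (iter (s + W) U) (iter (s + W) (A @ [x]))"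
            unfolding dead_iter by (rule dead_mono) (simp add: Suc)
          then show "dead (W + 1) (iter s (iter W U)) ((iter s Q @ [z]) @ Z)"
            by (simp only: eq iter_iter)
        qed
        have "core_length Z = s * length g' + (length (c' @ c) + core_length (iter (s + W) [x]))"
          using x(1) by (simp add: Z_def core_length_append length_rep)
        moreover have "core_length (iter (s + W) [x]) > 0"
          using x(1) core_length_0[of "iter (s + W) [x]"] by (simp del: core_length_0)
        moreover have "s \<le> s * length g'" using g' by (cases g') auto
        ultimately show ?thesis using Suc Z by linarith
      qed simp
      then have "dead ((W + 1) * B) (iter W U) (Q @ [z])" using t(1) by (rule dead_mono[rotated])
      from transfer[OF this] show ?thesis
        by (rule dead_mono) (simp add: linear_bound_def algebra_simps)
    qed
    then show ?thesis ..
  qed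
qed

section \<open>Letters preceded by new non-constant letters\<close>

text \<open>In lemma names, a letter \<open>x\<close> is ``heavy'' if \<open>f x = e @ x # g\<close> with \<open>g\<close> constant and \<open>e\<close> not
  constant; \<open>pre e k A\<close> is then what precedes the last \<open>x\<close> in \<open>iter k (A @ [x])\<close>.\<close>

primrec ladder :: "'a list \<Rightarrow> nat \<Rightarrow> 'a list" where
  "ladder e 0 = []"
| "ladder e (Suc n) = concat (map f (ladder e n)) @ e"

definition pre :: "'a list \<Rightarrow> nat \<Rightarrow> 'a list \<Rightarrow> 'a list" where
  "pre e k A = iter k A @ ladder e k"

lemma ladder_add: "ladder e (j + k) = iter j (ladder e k) @ ladder e j"
  by (induction j) (auto simp: iter_Suc)

lemma pre_pre: "pre e j (pre e k A) = pre e (j + k) A"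
  by (simp add: pre_def ladder_add iter_iter)

lemma iter_ladder: "f x = e @ x # g \<Longrightarrow> const_word g \<Longrightarrow> iter n [x] = ladder e n @ x # rep n g"
  by (induction n) (auto simp: iter_Suc const_word_image const_word_rep)

lemma iter_pre:
  assumes "f x = e @ x # g" "const_word g"
  shows "iter k (A @ [x]) = (pre e k A @ [x]) @ rep k g"
  by (simp add: pre_def iter_ladder[OF assms])

lemma prefix_pre_image: "f x = e @ x # g \<Longrightarrow> const_word g \<Longrightarrow>
    prefix (pre e (Suc k) A @ [x]) (concat (map f (pre e k A @ [x])))"
  by (simp add: pre_def iter_Suc)

lemma length_image_nonconst:
  "length w + length (filter (\<lambda>x. f x \<noteq> [x]) w) \<le> length (concat (map f w))"
proof (induction w)
  case (Cons x w)
  have "1 \<le> length (f x)" using letter_image_nonempty[of x] by (simp add: Suc_le_eq)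
  with Cons length_nonconstant_image[of x] show ?case by auto
qed simp

lemma nonconst_image:
  "length (filter (\<lambda>x. f x \<noteq> [x]) w) \<le> length (filter (\<lambda>x. f x \<noteq> [x]) (concat (map f w)))"
proof (induction w)
  case (Cons x w)
  have "1 \<le> length (filter (\<lambda>x. f x \<noteq> [x]) (f x))" if "f x \<noteq> [x]"
    using that self_occurs[of x] by (auto simp: Suc_le_eq filter_empty_conv)
  with Cons show ?case by auto
qed simp

text \<open>The ladder is the product f^(n-1)(e) ... f(e) e. Each factor contains a non-constant
  letter, so there are at least \<open>n\<close> of them, and each lengthens the word in the next
  step; the increments add up to quadratic length.\<close>

lemma core_length_ladder:
  assumes "\<not> const_word e"
  shows "n * n \<le> 2 * core_length (ladder e n)"
proof -
  have e1: "1 \<le> length (filter (\<lambda>x. f x \<noteq> [x]) e)"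
    using assms by (auto simp: const_word_def Suc_le_eq filter_empty_conv)
  have e2: "1 \<le> core_length e" using assms core_length_0[of e] by linarith
  have nc: "n \<le> length (filter (\<lambda>x. f x \<noteq> [x]) (ladder e n))" for n
  proof (induction n)
    case (Suc n)
    then show ?case using e1 nonconst_image[of "ladder e n"] by (simp del: filter_concat)
  qed simp
  have le: "core_length w \<le> length w" for w
    using length_dropWhile_le[of _ "rev w"] by (simp add: core_length_def)
  show ?thesis
  proof (induction n)
    case (Suc n)
    have "core_length (ladder e (Suc n)) = length (concat (map f (ladder e n))) + core_length e"
      using assms by (simp add: core_length_append)
    then have "core_length (ladder e n) + n + 1 \<le> core_length (ladder e (Suc n))"
      using e2 nc[of n] length_image_nonconst[of "ladder e n"] le[of "ladder e n"] by linarith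
    with Suc show ?case by simp
  qed simp
qed

text \<open>Chosen so that \<open>2 * ((lag + 1) * B) < lag * lag\<close>: a ladder of height
  \<open>lag\<close> behind a survivor is too long to die within \<open>lag + 1\<close>
  steps.\<close>

definition lag :: nat where "lag = 4 * B + 1"

text \<open>If \<open>A\<close> survived for \<open>t > lag\<close> steps, the images of \<open>e\<close> piled up behind it would have
  quadratic length, so \<open>pre e t A\<close> would in turn survive for more than \<open>lag\<close> steps, and so on
  forever.\<close>

lemma heavy_predecessor_dead:
  assumes x: "f x = e @ x # g" "\<not> const_word e" "const_word g"
  shows "dead n U (A @ [x]) \<Longrightarrow> dead lag U A"
proof (induction n arbitrary: U A rule: less_induct)
  case (less n)
  obtain t where t: "dead t U A" "t \<le> n" "\<And>s. s < t \<Longrightarrow> \<not> dead s U A"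
    using first_death[OF dead_left[OF less.prems]] by metis
  show ?case
  proof (cases "t \<le> lag")
    case True
    then show ?thesis using t(1) by (rule dead_mono[rotated])
  next
    case False
    then obtain s where s: "t = Suc s" "lag \<le> s" by (cases t) auto
    have "dead (n - t) (iter t U) (iter t (A @ [x]))"
      using less.prems t(2) by (simp only: dead_iter) simp
    then have "dead (n - t) (iter t U) (pre e t A @ [x])"
      unfolding iter_pre[OF x(1,3)] by (rule dead_left)
    moreover have "n - t < n" using s t(2) by simp
    \<comment> \<open>Fewer than \<open>n\<close> steps remain after time \<open>t\<close>, so the
      induction hypothesis applies to the words at that time.\<close>
    ultimately have "dead lag (iter t U) (pre e t A)" using less.IH by blast
    moreover have "pre e t A = iter 1 (pre e s A) @ e"
      using s(1) by (simp add: pre_def iter_Suc)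
    ultimately have "dead lag (iter 1 (iter s U)) (iter 1 (pre e s A))"
      using s(1) by (auto simp: iter_iter dest: dead_left)
    then have "dead (lag + 1) (iter s U) (iter s A @ ladder e s)"
      by (simp only: dead_iter pre_def)
    moreover have "\<not> absorbs (iter s U) (iter s A)" using t(3)[of s] s(1) by (simp add: dead_def)
    ultimately have "core_length (ladder e s) \<le> (lag + 1) * B"
      using core_length_after_survivor by blast
    then have "s * s \<le> 2 * ((lag + 1) * B)" using core_length_ladder[OF x(2), of s] by linarith
    moreover have "lag * lag \<le> s * s" using s(2) by (rule mult_le_mono[OF _ s(2)])
    moreover have "2 * ((lag + 1) * B) < lag * lag" by (simp add: lag_def algebra_simps)
    ultimately show ?thesis by linarith
  qed
qed

text \<open>One step later the bound covers \<open>iter 1 A @ e\<close>. As \<open>e\<close> is not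
  constant, any unmatched constant end lies within the image of \<open>e\<close>, and the image of
  \<open>A\<close> is matched completely.\<close>

lemma heavy_predecessor_prefix:
  assumes x: "f x = e @ x # g" "\<not> const_word e" "const_word g" and "dead n U (A @ [x])"
  shows "prefix (iter (lag + 1) A) (iter (lag + 1) U)"
proof -
  have "dead n (iter 1 U) (iter 1 (A @ [x]))" using assms(4) by (rule dead_later)
  then have "dead n (iter 1 U) (pre e 1 A @ [x])"
    unfolding iter_pre[OF x(1,3)] by (rule dead_left)
  then have "dead lag (iter 1 U) (pre e 1 A)" by (rule heavy_predecessor_dead[OF x])
  then obtain p r where pr: "prefix p (iter (lag + 1) U)" "iter (lag + 1) A @ iter lag e = p @ r" "const_word r"
    by (auto simp: dead_def pre_def absorbs_def iter_iter)
  have "\<not> const_word (iter lag e)" using x(2) by simp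
  then obtain z where "p = iter (lag + 1) A @ z"
    using const_word_suffix_of_nonconst[of p r "iter (lag + 1) A" "iter lag e"] pr by metis
  with pr(1) show ?thesis by (auto simp: prefix_def)
qed

section \<open>Periodicity\<close>

text \<open>The same pair reappears behind a common prefix after \<open>n\<close> steps, hence after
  every multiple of \<open>n\<close>. At time \<open>m * n\<close> the parts behind that prefix
  still have different first letters, and the second is not constant.\<close>

lemma periodic_not_dead:
  assumes "apart X Y" "\<not> const_word Y" "prefix (p @ X) (iter n X)" "prefix (p @ Y) (iter n Y)" "n > 0"
  shows "\<not> dead m X Y"
proof
  assume "dead m X Y"
  have "\<exists>p. prefix (p @ X) (iter (k * n) X) \<and> prefix (p @ Y) (iter (k * n) Y)" for k
  proof (induction k)
    case (Suc k)
    then obtain q where q: "prefix (q @ X) (iter (k * n) X)" "prefix (q @ Y) (iter (k * n) Y)" by blast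
    have *: "prefix ((iter n q @ p) @ Z) (iter (Suc k * n) Z)"
      if Z: "prefix (q @ Z) (iter (k * n) Z)" "prefix (p @ Z) (iter n Z)" for Z
    proof -
      have "prefix (iter n q @ p @ Z) (iter n q @ iter n Z)" using Z(2) by simp
      also have "\<dots> = iter n (q @ Z)" by simp
      also have "prefix \<dots> (iter n (iter (k * n) Z))" using Z(1) by (rule prefix_iter)
      finally show ?thesis by (simp add: iter_iter)
    qed
    show ?case using *[OF q(1) assms(3)] *[OF q(2) assms(4)] by blast
  qed (auto intro!: exI[of _ "[]"])
  then obtain q X1 Y1 where q: "iter (m * n) X = q @ X @ X1" "iter (m * n) Y = q @ Y @ Y1"
    unfolding prefix_def append_assoc by meson
  have "m \<le> m * n" using assms(5) by simp
  then have "dead (m * n) X Y" using \<open>dead m X Y\<close> by (rule dead_mono[rotated])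
  then have "absorbs (X @ X1) (Y @ Y1)" by (simp add: dead_def q absorbs_cancel)
  \<comment> \<open>With both words non-empty, \<open>apart\<close> survives appending
    \<open>X1\<close> and \<open>Y1\<close>.\<close>
  moreover have "X \<noteq> []"
  proof
    assume "X = []"
    with \<open>dead m X Y\<close> have "const_word (iter m Y)" by (auto simp: dead_def absorbs_def)
    with assms(2) show False by simp
  qed
  moreover have "Y \<noteq> []" using assms(2) by auto
  ultimately have "apart (X @ X1) (Y @ Y1)" using assms(1) by (simp add: apart_def)
  with \<open>absorbs (X @ X1) (Y @ Y1)\<close> have "const_word (Y @ Y1)" by (rule absorbs_apart)
  with assms(2) show False by simp
qed

definition state_count :: "nat \<Rightarrow> nat" where
  "state_count L = card ({w :: 'a list. length w \<le> L} \<times> {w :: 'a list. length w \<le> L})"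

text \<open>By pigeonhole the same pair of uncancelled parts occurs at two times, and
  \<open>periodic_not_dead\<close> applies from the first of them on. The words may be cut shorter
  at each step, which is how callers keep the uncancelled parts bounded.\<close>

lemma bounded_residual_not_dead:
  assumes X: "\<And>k. k < state_count L \<Longrightarrow> prefix (X (Suc k)) (concat (map f (X k)))"
    and Y: "\<And>k. k < state_count L \<Longrightarrow> prefix (Y (Suc k)) (concat (map f (Y k)))"
    and res: "\<And>k p X' Y'. k \<le> state_count L \<Longrightarrow> X k = p @ X' \<Longrightarrow> Y k = p @ Y' \<Longrightarrow> apart X' Y' \<Longrightarrow>
      length X' \<le> L \<and> length Y' \<le> L \<and> \<not> const_word X' \<and> \<not> const_word Y'"
  shows "\<not> dead m (X 0) (Y 0)" "\<not> dead m (Y 0) (X 0)"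
proof -
  let ?N = "state_count L"
  let ?S = "{w :: 'a list. length w \<le> L}"
  have "\<exists>p X' Y'. X k = p @ X' \<and> Y k = p @ Y' \<and> apart X' Y'" for k
    by (rule apart_decomposition) blast
  then obtain P X' Y' where d: "\<And>k. X k = P k @ X' k" "\<And>k. Y k = P k @ Y' k" "\<And>k. apart (X' k) (Y' k)"
    by metis
  note r = res[OF _ d]
  have fin: "finite ?S" using finite_lists_length_le[of "UNIV :: 'a set" L] by simp
  have "\<not> inj_on (\<lambda>k. (X' k, Y' k)) {..?N}"
  proof
    assume inj: "inj_on (\<lambda>k. (X' k, Y' k)) {..?N}"
    have "card {..?N} \<le> card (?S \<times> ?S)"
      by (rule card_inj_on_le[OF inj]) (use r fin in auto)
    then show False by (simp add: state_count_def)
  qed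
  then obtain i j where ij: "i < j" "j \<le> ?N" "X' i = X' j" "Y' i = Y' j"
    by (auto simp: inj_on_def) (metis linorder_neqE_nat)
  have Xs: "prefix (Z (i + l)) (iter l (Z i))"
    if "\<And>k. k < ?N \<Longrightarrow> prefix (Z (Suc k)) (concat (map f (Z k)))" "i + l \<le> ?N" for Z i l
    using that(2)
  proof (induction l)
    case (Suc l)
    have "prefix (Z (Suc (i + l))) (iter 1 (Z (i + l)))" using Suc.prems that(1) by (simp add: iter_1)
    also have "prefix \<dots> (iter 1 (iter l (Z i)))" using Suc by (intro prefix_iter) simp
    finally show ?case by (simp add: iter_iter)
  qed simp
  define n where "n = j - i"
  have n: "n > 0" "j = i + n" using ij(1) by (auto simp: n_def)
  have pX: "prefix (X j) (iter n (X i))" and pY: "prefix (Y j) (iter n (Y i))"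
    using Xs[of X i n, OF X] Xs[of Y i n, OF Y] n ij(2) by auto
  have ne: "X' j \<noteq> []" "Y' j \<noteq> []" using r[OF ij(2)] by auto
  obtain X1 Y1 where X1: "iter n (X i) = P j @ X' j @ X1" "iter n (Y i) = P j @ Y' j @ Y1"
    using pX pY d by (auto simp: prefix_def)
  have "apart (X' j @ X1) (Y' j @ Y1)" using ne d(3)[of j] by (simp add: apart_def)
  \<comment> \<open>The image of the old common prefix is a common prefix of both images. Their
    longest one is \<open>P j\<close>, because the non-empty rests \<open>X' j\<close> and
    \<open>Y' j\<close> already differ.\<close>
  then have "prefix (iter n (P i)) (P j)"
  proof (rule apart_common_prefix)
    show "prefix (iter n (P i)) (P j @ X' j @ X1)" by (simp add: d flip: X1)
    show "prefix (iter n (P i)) (P j @ Y' j @ Y1)" by (simp add: d flip: X1)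
  qed
  then obtain q where q: "P j = iter n (P i) @ q" by (auto simp: prefix_def)
  have "prefix (q @ X' i) (iter n (X' i))" "prefix (q @ Y' i) (iter n (Y' i))"
    using pX pY by (simp_all add: d q ij)
  with d(3)[of i] r[of i] ij n have nd: "\<not> dead m (X' i) (Y' i)" "\<not> dead m (Y' i) (X' i)"
    using periodic_not_dead[of "X' i" "Y' i" q n m] periodic_not_dead[of "Y' i" "X' i" q n m]
    by (auto intro: apart_sym)
  have i: "prefix (X i) (iter i (X 0))" "prefix (Y i) (iter i (Y 0))"
    using Xs[of X 0 i, OF X] Xs[of Y 0 i, OF Y] ij by auto
  \<comment> \<open>Death at time 0 passes to the truncated words only up to exchanging them, so
    both directions have to be excluded together.\<close>
  have "\<not> dead m (X i) (Y i)" "\<not> dead m (Y i) (X i)" using nd by (simp_all add: d dead_cancel)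
  then show "\<not> dead m (X 0) (Y 0)" "\<not> dead m (Y 0) (X 0)"
    using dead_either[OF dead_later i, of m] dead_either[OF dead_later i(2) i(1), of m] by blast+
qed

section \<open>Bounding the death times\<close>

definition max_length :: "nat \<Rightarrow> nat" where
  "max_length k = Max (range (\<lambda>x. length (iter k [x])))"

lemma length_iter_letter: "length (iter k [x]) \<le> max_length k"
  unfolding max_length_def by (intro Max_ge) auto

lemma length_ladder: "f x = e @ x # g \<Longrightarrow> const_word g \<Longrightarrow> Suc (length (ladder e k)) \<le> max_length k"
  using length_iter_letter[of k x] by (simp add: iter_ladder)

lemma dead_pre:
  assumes "f x = e @ x # g" "const_word g" "dead n U (A @ [x])"
  shows "dead n (iter k U) (pre e k A @ [x])"
proof -
  have "dead n (iter k U) (iter k (A @ [x]))" using assms(3) by (rule dead_later)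
  then show ?thesis unfolding iter_pre[OF assms(1,2)] by (rule dead_left)
qed

lemma dead_pre_D:
  assumes "f x = e @ x # g" "const_word g" "dead n (iter k U) (pre e k A @ [x])"
  shows "dead (n + k) U (A @ [x])"
proof -
  have "dead n (iter k U) (iter k (A @ [x]))"
    unfolding iter_pre[OF assms(1,2)] using assms(3) const_word_rep[OF assms(2)] by (rule dead_append_const_word)
  then show ?thesis by (simp only: dead_iter)
qed

lemma heavy_predecessor_prefix_later:
  assumes "f x = e @ x # g" "\<not> const_word e" "const_word g" "dead n U (A @ [x])"
  shows "prefix (iter (lag + 1) (pre e k A)) (iter (lag + 1 + k) U)"
  using heavy_predecessor_prefix[OF assms(1-3) dead_pre[OF assms(1,3,4)]]
  by (simp only: iter_iter)

lemma pre_split: "pre e (j + k) A = iter j (pre e k A) @ ladder e j"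
  by (metis pre_def pre_pre)

text \<open>A common prefix \<open>a\<close> lies inside the longest one, so only what follows
  \<open>a\<close> can be left uncancelled.\<close>

lemma residual_length:
  assumes "apart X' Y'" "prefix a (p @ X')" "p @ Y' = a @ z"
  shows "length Y' \<le> length z"
proof -
  have "prefix a p" by (rule apart_common_prefix[OF assms(1,2)]) (simp add: assms(3))
  then have "length a \<le> length p" by (rule prefix_length_le)
  moreover have "length p + length Y' = length a + length z"
    using assms(3) by (metis length_append)
  ultimately show ?thesis by linarith
qed

section \<open>Duels between letters of the two words\<close>

definition duel_bound :: nat where
  "duel_bound = lag + 1 + state_count (max_length (lag + 1))"

text \<open>Suppose both letters outlive the bound. From time \<open>lag + 1\<close> on, what
  precedes each letter is, up to a ladder of height \<open>lag + 1\<close>, a prefix of the other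
  word. So the uncancelled parts are bounded, and \<open>bounded_residual_not_dead\<close>
  contradicts \<open>dw\<close>.\<close>

lemma heavy_duel:
  assumes x: "f x = e @ x # g" "\<not> const_word e" "const_word g"
    and w: "f w = d @ w # h" "\<not> const_word d" "const_word h"
    and dx: "dead n U (A @ [x])" and Q: "prefix (Q @ [w]) U" and dw: "dead m (A @ [x]) (Q @ [w])"
  shows "dead duel_bound (A @ [x]) (Q @ [w]) \<or> dead duel_bound (Q @ [w]) (A @ [x])"
proof (rule ccontr)
  assume neg: "\<not> ?thesis"
  define L where "L = max_length (lag + 1)"
  define X where "X k = pre d (lag + 1 + k) Q @ [w]" for k
  define Y where "Y k = pre e (lag + 1 + k) A @ [x]" for k
  have itX: "iter (lag + 1 + k) (Q @ [w]) = X k @ rep (lag + 1 + k) h" for k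
    unfolding X_def by (rule iter_pre[OF w(1,3)])
  have itY: "iter (lag + 1 + k) (A @ [x]) = Y k @ rep (lag + 1 + k) g" for k
    unfolding Y_def by (rule iter_pre[OF x(1,3)])
  have alive: "\<not> absorbs (Y k) (X k)" "\<not> absorbs (X k) (Y k)" if "k \<le> state_count L" for k
  proof -
    have le: "lag + 1 + k \<le> duel_bound" using that by (simp add: duel_bound_def L_def)
    show "\<not> absorbs (Y k) (X k)"
    proof
      assume "absorbs (Y k) (X k)"
      then have "absorbs (Y k @ rep (lag + 1 + k) g) (X k @ rep (lag + 1 + k) h)"
        by (intro absorbs_append_const_word const_word_rep w) (erule absorbs_mono, simp)
      then have "dead (lag + 1 + k) (A @ [x]) (Q @ [w])" by (simp only: dead_def itX itY)
      with le neg show False by (blast intro: dead_mono)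
    qed
    show "\<not> absorbs (X k) (Y k)"
    proof
      assume "absorbs (X k) (Y k)"
      then have "absorbs (X k @ rep (lag + 1 + k) h) (Y k @ rep (lag + 1 + k) g)"
        by (intro absorbs_append_const_word const_word_rep x) (erule absorbs_mono, simp)
      then have "dead (lag + 1 + k) (Q @ [w]) (A @ [x])" by (simp only: dead_def itX itY)
      with le neg show False by (blast intro: dead_mono)
    qed
  qed
  have *: "\<not> dead i (X 0) (Y 0) \<and> \<not> dead i (Y 0) (X 0)" for i
  proof -
    have "length X' \<le> L \<and> length Y' \<le> L \<and> \<not> const_word X' \<and> \<not> const_word Y'"
      if k: "k \<le> state_count L" and eq: "X k = p @ X'" "Y k = p @ Y'" "apart X' Y'" for k p X' Y'
    proof (intro conjI)
      let ?a = "iter (lag + 1) (pre d k Q)" and ?b = "iter (lag + 1) (pre e k A)"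
      have Xk: "X k = ?a @ ladder d (lag + 1) @ [w]" unfolding X_def by (simp only: pre_split append_assoc)
      have Yk: "Y k = ?b @ ladder e (lag + 1) @ [x]" unfolding Y_def by (simp only: pre_split append_assoc)
      have "prefix (X k) (iter (lag + 1 + k) U)"
        using prefix_iter[OF Q, of "lag + 1 + k"] unfolding itX by (rule append_prefixD)
      moreover have "prefix ?b (iter (lag + 1 + k) U)"
        by (rule heavy_predecessor_prefix_later[OF x dx])
      moreover have "prefix ?b (Y k)" unfolding Yk by simp
      \<comment> \<open>Both are prefixes of the iterate of \<open>U\<close>, hence comparable; if
        \<open>X k\<close> were the shorter one, \<open>Y k\<close> would absorb it.\<close>
      ultimately have "prefix ?b (X k)"
        using alive(1)[OF k] by (meson absorbs_prefix prefix_order.trans prefix_same_cases)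
      then have "length Y' \<le> length (ladder e (lag + 1) @ [x])"
        by (intro residual_length[OF eq(3) _ trans[OF eq(2)[symmetric] Yk]]) (simp only: eq(1))
      then show "length Y' \<le> L" using length_ladder[OF x(1,3), of "lag + 1"] by (simp add: L_def)
      have "prefix ?a (iter (lag + 1 + k) (A @ [x]))"
        by (rule heavy_predecessor_prefix_later[OF w dw])
      then have "prefix ?a (Y k @ rep (lag + 1 + k) g)" by (simp only: itY)
      moreover have "prefix ?a (X k)" unfolding Xk by simp
      ultimately have "prefix ?a (Y k)"
        using alive(2)[OF k] by (meson absorbs_prefix prefixI prefix_order.trans prefix_same_cases)
      then have "length X' \<le> length (ladder d (lag + 1) @ [w])"
        by (intro residual_length[OF apart_sym[OF eq(3)] _ trans[OF eq(1)[symmetric] Xk]])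
          (simp only: eq(2))
      then show "length X' \<le> L" using length_ladder[OF w(1,3), of "lag + 1"] by (simp add: L_def)
      show "\<not> const_word X'" using alive(1)[OF k] eq by (auto simp: absorbs_cancel intro: absorbs_const_word)
      show "\<not> const_word Y'" using alive(2)[OF k] eq by (auto simp: absorbs_cancel intro: absorbs_const_word)
    qed
    moreover have "prefix (X (Suc k)) (concat (map f (X k)))" for k
      using prefix_pre_image[OF w(1,3), of "lag + 1 + k" Q] by (simp add: X_def)
    moreover have "prefix (Y (Suc k)) (concat (map f (Y k)))" for k
      using prefix_pre_image[OF x(1,3), of "lag + 1 + k" A] by (simp add: Y_def)
    ultimately show ?thesis
      using bounded_residual_not_dead[of L X Y i] by blast
  qed
  have "dead m (iter (lag + 1 + 0) (A @ [x])) (iter (lag + 1 + 0) (Q @ [w]))"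
    using dw by (rule dead_later)
  then have "dead m (Y 0) (X 0) \<or> dead m (X 0) (Y 0)"
    by (rule dead_either) (simp_all only: itX itY prefixI)
  with * show False by blast
qed

text \<open>In the duel started at time \<open>i\<close> only \<open>w\<close> can lose: if
  \<open>Q @ [w]\<close> killed \<open>x\<close>, so would the longer iterate of \<open>U\<close>,
  against \<open>alive\<close>.\<close>

lemma heavy_rival_dead:
  assumes x: "f x = e @ x # g" "\<not> const_word e" "const_word g"
    and w: "f w = d @ w # h" "\<not> const_word d" "const_word h"
    and "dead n U (A @ [x])" "prefix (Q @ [w]) (iter i U)" "dead m (iter i (A @ [x])) (Q @ [w])"
    and alive: "\<not> dead (duel_bound + i) U (A @ [x])"
  shows "dead duel_bound (iter i (A @ [x])) (Q @ [w])"
proof -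
  have "dead m ((pre e i A @ [x]) @ rep i g) (Q @ [w])"
    using assms(9) unfolding iter_pre[OF x(1,3)] .
  then have "dead m (pre e i A @ [x]) (Q @ [w])" using const_word_rep[OF x(3)] by (rule dead_drop_const_word)
  from heavy_duel[OF x w dead_pre[OF x(1,3) assms(7)] assms(8) this]
  show ?thesis
  proof
    assume "dead duel_bound (pre e i A @ [x]) (Q @ [w])"
    then show ?thesis by (rule dead_append_mono) (simp only: iter_pre[OF x(1,3)] prefixI)
  next
    assume "dead duel_bound (Q @ [w]) (pre e i A @ [x])"
    then have "dead duel_bound (iter i U) (pre e i A @ [x])"
      using assms(8) by (rule dead_append_mono)
    with alive show ?thesis using dead_pre_D[OF x(1,3)] by blast
  qed
qed

definition rival_bound :: nat where
  "rival_bound = 3 * W + duel_bound + linear_bound"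

text \<open>Meant for the part \<open>Q\<close> of \<open>U\<close> in front of the letter that will
  cancel \<open>x\<close>. Its last non-constant letter, once stabilised, is heavy and loses a duel,
  or is of linear growth; then \<open>linear_dead_or_reduce\<close> bounds its death or leads back
  to a heavy letter.\<close>

lemma rival_dead:
  assumes x: "f x = e @ x # g" "\<not> const_word e" "const_word g"
    and dx: "dead n U (A @ [x])" and alive: "\<not> dead rival_bound U (A @ [x])"
    and Q: "prefix Q U" and dQ: "dead m (A @ [x]) Q"
  shows "dead rival_bound (A @ [x]) Q"
proof (cases "const_word Q")
  case False
  then obtain Q' w c where Q': "Q = Q' @ w # c" "const_word c" "f w \<noteq> [w]" using last_nonconst by blast
  obtain r z c' s h where z: "iter W [w] = r @ z # c'" "const_word c'" "f z \<noteq> [z]" "f z = s @ z # h" "const_word h"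
    using iter_last_nonconst[OF Q'(3)] by metis
  define R where "R = iter W Q' @ r"
  define V where "V = A @ [x]"
  have WQ: "iter W Q = (R @ [z]) @ c' @ c"
  proof -
    have "iter W Q = iter W (Q' @ [w] @ c)" using Q'(1) by simp
    then show ?thesis using Q'(2) z(1) by (simp only: iter_append iter_const_word) (simp add: R_def)
  qed
  have cc: "const_word (c' @ c)" using Q' z by simp
  have suff: "dead rival_bound V Q"
    if "dead t (iter W V) (R @ [z])" "t + W \<le> rival_bound" for t
  proof -
    have "dead t (iter W V) (iter W Q)" unfolding WQ using that(1) cc by (rule dead_append_const_word)
    then show ?thesis using that(2) by (simp add: dead_iter dead_mono)
  qed
  have dz: "dead m (iter W V) (R @ [z])"
    using dead_later[OF dQ, of W] unfolding WQ V_def by (rule dead_left)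
  have pz: "prefix (R @ [z]) (iter W U)"
    using prefix_iter[OF Q, of W] unfolding WQ by (rule append_prefixD)
  \<comment> \<open>Duels start at time \<open>W\<close>, or at time \<open>2 * W\<close> after a
    reduction to an earlier letter.\<close>
  have alive': "\<not> dead (duel_bound + i) U (A @ [x])" if "i \<le> 2 * W" for i
    using alive that by (auto simp: rival_bound_def intro: dead_mono)
  have "dead rival_bound V Q"
  proof (cases "const_word s")
    case False
    have "dead duel_bound (iter W (A @ [x])) (R @ [z])"
      using heavy_rival_dead[OF x z(4) False z(5) dx pz _ alive'] dz unfolding V_def by simp
    then show ?thesis using suff unfolding V_def by (simp add: rival_bound_def)
  next
    case True
    from linear_dead_or_reduce[OF z(3,4) True z(5) dz] show ?thesis
    proof (elim disjE exE conjE)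
      assume "dead linear_bound (iter W V) (R @ [z])"
      then show ?thesis by (rule suff) (simp add: rival_bound_def)
    next
      fix R' y d h'
      assume y: "f y = d @ y # h'" "\<not> const_word d" "const_word h'" and p: "prefix (R' @ [y]) (iter W R)"
        and red: "\<forall>t. dead t (iter W (iter W V)) (R' @ [y]) \<longrightarrow> dead (t + 2 * W) (iter W V) (R @ [z])"
      have "prefix (iter W (R @ [z])) (iter W (iter W U))" using pz by (rule prefix_iter)
      then have "prefix (R' @ [y]) (iter (W + W) U)"
        using p by (metis append_prefixD iter_append iter_iter prefix_order.trans)
      moreover have "dead m (iter W (iter W V)) (iter W (R @ [z]))" using dz by (rule dead_later)
      then have "dead m (iter (W + W) V) (R' @ [y])"
        using p by (metis dead_left dead_prefix_left iter_append iter_iter)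
      ultimately have "dead duel_bound (iter (W + W) V) (R' @ [y])"
        using heavy_rival_dead[OF x y dx, of R' "W + W" m] alive'[of "W + W"] unfolding V_def by simp
      with red have "dead (duel_bound + 2 * W) (iter W V) (R @ [z])" by (simp add: iter_iter)
      then show ?thesis by (rule suff) (simp add: rival_bound_def)
    qed
  qed
  then show ?thesis by (simp add: V_def)
qed (rule dead_const_word)

text \<open>At time \<open>t\<close> the iterate of \<open>Q\<close> may exceed its match in
  \<open>V\<close> by constants \<open>r\<close>. Since \<open>U\<close> later kills
  \<open>V\<close>, a further non-constant letter is matched after \<open>W\<close> steps, and with
  it the constants \<open>r\<close> in front of it.\<close>

lemma rival_swallowed:
  assumes "dead t V Q" "prefix Q U" "\<not> dead t U V" "dead n U V"
  shows "prefix (iter (t + W) Q) (iter (t + W) V)"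
proof -
  from assms(1) obtain p r V' where pr: "iter t V = p @ V'" "iter t Q = p @ r" "const_word r"
    by (auto simp: dead_def absorbs_def prefix_def)
  obtain S where S: "iter t U = p @ r @ S"
    using prefix_iter[OF assms(2), of t] pr by (auto simp: prefix_def)
  have "dead n (r @ S) V'" using dead_later[OF assms(4), of t] by (simp add: pr S dead_cancel)
  moreover have "\<not> const_word V'" using assms(3) by (auto simp: dead_def pr S absorbs_cancel intro: absorbs_const_word)
  ultimately obtain c y U1 V1 where c: "iter W (r @ S) = c @ y # U1" "iter W V' = c @ y # V1"
    "const_word c" "f y \<noteq> [y]"
    by (rule nonconst_matched)
  have "prefix r (c @ y # U1)" using c(1) pr(3) by (metis iter_append iter_const_word prefixI)
  then have "prefix r c" using pr(3) c(4) by (auto simp: prefix_append prefix_Cons)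
  then have "prefix (iter W (p @ r)) (iter W (p @ V'))"
    using pr(3) c(2) by (auto simp: prefix_def)
  then show ?thesis using pr by (metis add.commute iter_iter)
qed

text \<open>After \<open>k\<close> steps everything in front of the rival letter is matched. The
  uncancelled parts then have at most the length given to \<open>state_count\<close>, and that many
  further steps force a repetition.\<close>

definition heavy_bound :: nat where
  "heavy_bound = (let k = rival_bound + W in
     k + state_count (max_length k + max_length (lag + 1)) + rival_bound)"

text \<open>\<open>X k\<close> is the shortest prefix of \<open>iter k U\<close> whose image at the time \<open>T\<close> of death contains the
  letter that cancels the distinguished occurrence of \<open>x\<close>.\<close>

lemma heavy_dead:
  assumes x: "f x = e @ x # g" "\<not> const_word e" "const_word g" and dx: "dead n U (A @ [x])"
  shows "dead heavy_bound U (A @ [x])"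
proof (rule ccontr)
  assume neg: "\<not> dead heavy_bound U (A @ [x])"
  obtain T where T: "dead T U (A @ [x])" "\<And>s. s < T \<Longrightarrow> \<not> dead s U (A @ [x])"
    using first_death[OF dx] by metis
  have xn: "f x \<noteq> [x]" using x(1,2) by (cases e) auto
  define k0 where "k0 = rival_bound + W"
  define L where "L = max_length k0 + max_length (lag + 1)"
  have hb: "heavy_bound = k0 + state_count L + rival_bound"
    by (simp add: heavy_bound_def Let_def k0_def L_def)
  have Tb: "heavy_bound < T" using neg T(1) by (meson dead_mono not_le_imp_less)
  \<comment> \<open>At time \<open>T\<close> the \<open>x\<close> behind \<open>E\<close> is matched
    by the letter of \<open>U\<close> at position \<open>length E\<close>; a prefix reaches it iff
    its length exceeds \<open>length E\<close>.\<close>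
  define E where "E = pre e T A"
  have ET: "prefix (E @ [x]) (iter T U)"
  proof -
    obtain p r where pr: "prefix p (iter T U)" "E @ x # rep T g = p @ r" "const_word r"
      using T(1) unfolding dead_def iter_pre[OF x(1,3)] absorbs_def E_def by auto
    have "\<not> const_word (x # rep T g)" using xn by simp
    then obtain z where z: "p = E @ z" "x # rep T g = z @ r"
      using const_word_suffix_of_nonconst[of p r E "x # rep T g"] pr by metis
    then obtain z' where "z = x # z'" using pr(3) xn by (cases z) auto
    with z pr(1) show ?thesis by (auto simp: prefix_def)
  qed
  define X where "X k = take (LEAST m. length E < length (iter (T - k) (take m (iter k U)))) (iter k U)" for k
  have Xp: "prefix (X k) (iter k U)" for k unfolding X_def by (rule take_is_prefix)
  have Xmin: "prefix (X k) Z"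
    if "prefix Z (iter k U)" "length E < length (iter (T - k) Z)" for k Z
  proof -
    have Z: "Z = take (length Z) (iter k U)" using that(1) by (auto simp: prefix_def)
    have "(LEAST m. length E < length (iter (T - k) (take m (iter k U)))) \<le> length Z"
      using that(2) Z by (intro Least_le) simp
    then have "X k = take (LEAST m. length E < length (iter (T - k) (take m (iter k U))))
        (take (length Z) (iter k U))"
      by (simp add: X_def min_absorb1)
    then show ?thesis using Z take_is_prefix by metis
  qed
  have Xl: "length E < length (iter (T - k) (X k))" if "k \<le> T" for k
    unfolding X_def
  proof (rule LeastI)
    show "length E < length (iter (T - k) (take (length (iter k U)) (iter k U)))"
      using prefix_length_le[OF ET] that by (simp add: iter_iter)
  qed
  have Xstep: "prefix (X (l + k)) (iter l (X k))" if "l + k \<le> T" for k l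
  proof (rule Xmin)
    show "prefix (iter l (X k)) (iter (l + k) U)" using prefix_iter[OF Xp[of k], of l]
      by (simp add: iter_iter)
    have "T - (l + k) + l = T - k" using that by simp
    then show "length E < length (iter (T - (l + k)) (iter l (X k)))"
      using Xl[of k] that by (simp add: iter_iter)
  qed
  \<comment> \<open>Without its last letter, \<open>X k\<close> no longer reaches the cancelling
    letter, so the image of \<open>Q k\<close> at time \<open>T\<close> lies within
    \<open>E\<close>.\<close>
  define Q where "Q k = butlast (X k)" for k
  define u where "u k = last (X k)" for k
  have XQ: "X k = Q k @ [u k]" if "k \<le> T" for k
    using Xl[OF that] by (cases "X k = []") (auto simp: Q_def u_def)
  have QU: "prefix (Q k) (iter k U)" if "k \<le> T" for k
    using Xp[of k] unfolding XQ[OF that] by (rule append_prefixD)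
  have Ql: "length (iter (T - k) (Q k)) \<le> length E" if "k \<le> T" for k
  proof (rule ccontr)
    assume "\<not> ?thesis"
    then have "prefix (X k) (Q k)" using Xmin QU that by simp
    then show False unfolding XQ[OF that] by (auto dest: prefix_length_le)
  qed
  have EE: "prefix (iter (T - k) (pre e k A)) E" if "k \<le> T" for k
    using pre_split[of e "T - k" k A] that by (simp add: E_def)
  have XA: "\<not> prefix (X k) (pre e k A)" if "k \<le> T" for k
  proof
    assume "prefix (X k) (pre e k A)"
    then have "prefix (iter (T - k) (X k)) E"
      using EE[OF that] by (meson prefix_iter prefix_order.trans)
    then show False using Xl[OF that] prefix_length_le by fastforce
  qed
  have alive: "\<not> absorbs (iter k U) (pre e k A @ [x])" if "k < T" for k
    using T(2)[OF that] dead_pre_D[OF x(1,3), of 0 k U A] by (auto simp: dead_0)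
  have *: "\<not> dead i (X k0) (pre e k0 A @ [x]) \<and> \<not> dead i (pre e k0 A @ [x]) (X k0)" for i
  proof -
    have res: "length X' \<le> L \<and> length Y' \<le> L \<and> \<not> const_word X' \<and> \<not> const_word Y'"
      if j: "j \<le> state_count L" and eq: "X (k0 + j) = p @ X'" "pre e (k0 + j) A @ [x] = p @ Y'"
        "apart X' Y'" for j p X' Y'
    proof (intro conjI)
      let ?K = "k0 + j" and ?Y = "pre e (k0 + j) A @ [x]"
      let ?a = "iter k0 (Q j)"
      have KT: "?K < T" "rival_bound + j < T" "j \<le> T" using j Tb hb by (auto simp: k0_def)
      note aliveK = alive[OF KT(1)]
      have YU: "\<not> prefix ?Y (iter ?K U)" using aliveK absorbs_prefix by blast
      have XA': "\<not> prefix (X ?K) (pre e ?K A)" using XA KT(1) by simp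
      have dj: "dead n (iter j U) (pre e j A @ [x])" by (rule dead_pre[OF x(1,3) dx])
      have aj: "\<not> dead rival_bound (iter j U) (pre e j A @ [x])"
        using T(2)[OF KT(2)] dead_pre_D[OF x(1,3)] by blast
      have "dead (T - j) (pre e j A @ [x]) (Q j)"
      proof -
        have "prefix (iter (T - j) (Q j)) (iter T U)"
          using prefix_iter[OF QU[OF KT(3)], of "T - j"] KT(3) by (simp add: iter_iter)
        moreover have "prefix E (iter T U)" using ET by (rule append_prefixD)
        ultimately have "prefix (iter (T - j) (Q j)) E"
          using Ql[OF KT(3)] prefix_length_prefix by blast
        then have "prefix (iter (T - j) (Q j)) (iter (T - j) (pre e j A @ [x]))"
          unfolding iter_pre[OF x(1,3)] pre_pre using KT(3) by (simp add: E_def prefix_prefix)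
        then show ?thesis unfolding dead_def by (rule absorbs_prefix)
      qed
      \<comment> \<open>The rival is examined at time \<open>j\<close>; the delay \<open>k0\<close>
        turns its death into a prefix relation at time \<open>k0 + j\<close>.\<close>
      then have "dead rival_bound (pre e j A @ [x]) (Q j)"
        by (rule rival_dead[OF x dj aj QU[OF KT(3)]])
      then have "prefix ?a (iter k0 (pre e j A @ [x]))"
        unfolding k0_def by (rule rival_swallowed[OF _ QU[OF KT(3)] aj dj])
      then have aY': "prefix ?a (?Y @ rep k0 g)" unfolding iter_pre[OF x(1,3)] pre_pre .
      have aU: "prefix ?a (iter ?K U)"
        using prefix_iter[OF QU[OF KT(3)], of k0] by (simp add: iter_iter)
      have "prefix ?a ?Y"
        using aY' aU YU by (meson prefixI prefix_order.trans prefix_same_cases)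
      have "prefix ?a (X ?K)"
      proof (rule ccontr)
        assume "\<not> prefix ?a (X ?K)"
        then have "prefix (X ?K) ?a" using Xp aU prefix_same_cases by blast
        then have "prefix (X ?K) ?Y" using \<open>prefix ?a ?Y\<close> prefix_order.trans by blast
        then show False using XA' YU Xp[of ?K] by (auto simp: prefix_snoc)
      qed
      then obtain z where z: "X ?K = ?a @ z" by (auto simp: prefix_def)
      \<comment> \<open>Behind the matched \<open>?a\<close>, only a piece of the image of the
        single letter \<open>u j\<close> can be left.\<close>
      have "prefix (X ?K) (iter k0 (X j))" using Xstep KT(1) by simp
      then have "prefix z (iter k0 [u j])" unfolding z XQ[OF KT(3)] by simp
      then have "length z \<le> max_length k0"
        using prefix_length_le length_iter_letter order_trans by blast
      moreover have "length X' \<le> length z"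
        using residual_length[of Y' X' ?a p z] eq z \<open>prefix ?a ?Y\<close> by (simp add: apart_sym)
      ultimately show "length X' \<le> L" by (simp add: L_def)
      \<comment> \<open>Going back \<open>lag + 1\<close> steps leaves only a ladder of that height,
        and \<open>x\<close>, possibly unmatched.\<close>
      define i where "i = ?K - (lag + 1)"
      have i: "?K = lag + 1 + i"
        by (simp add: i_def k0_def rival_bound_def duel_bound_def)
      let ?b = "iter (lag + 1) (pre e i A)"
      have bU: "prefix ?b (iter ?K U)" unfolding i by (rule heavy_predecessor_prefix_later[OF x dx])
      have bY: "pre e ?K A = ?b @ ladder e (lag + 1)" unfolding i by (rule pre_split)
      have "prefix ?b (X ?K)"
        using bU Xp[of ?K] XA' bY by (metis prefixI prefix_order.trans prefix_same_cases)
      then have "length Y' \<le> length (ladder e (lag + 1) @ [x])"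
        by (intro residual_length[OF eq(3) _ trans[OF eq(2)[symmetric]]])
          (simp_all only: eq(1) bY append_assoc)
      then show "length Y' \<le> L" using length_ladder[OF x(1,3), of "lag + 1"] by (simp add: L_def)
      show "\<not> const_word Y'"
      proof
        assume "const_word Y'"
        then have "absorbs (X ?K) ?Y" using eq by (simp add: absorbs_cancel absorbs_const_word)
        then show False using aliveK Xp absorbs_mono by blast
      qed
      show "\<not> const_word X'"
      proof
        \<comment> \<open>A constant rest would stay unchanged until time \<open>T\<close> and could
          not supply the non-constant letter that cancels \<open>x\<close>.\<close>
        assume X': "const_word X'"
        have pU: "prefix p (iter ?K U)" using Xp[of ?K] unfolding eq(1) by (rule append_prefixD)
        have "prefix p ?Y" unfolding eq(2) by simp
        then have "prefix p (pre e ?K A)" using pU YU by (auto simp: prefix_snoc)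
        then have "prefix (iter (T - ?K) p) E"
          using EE[of ?K] KT(1) by (meson less_imp_le prefix_iter prefix_order.trans)
        then obtain z where z: "E = iter (T - ?K) p @ z" by (auto simp: prefix_def)
        have XT: "iter (T - ?K) (X ?K) = iter (T - ?K) p @ X'" using X' by (simp add: eq(1))
        have "prefix (iter (T - ?K) (X ?K)) (iter T U)"
          using prefix_iter[OF Xp[of ?K], of "T - ?K"] KT(1) by (simp add: iter_iter)
        then have "prefix (E @ [x]) (iter (T - ?K) (X ?K))"
          using Xl[of ?K] KT(1) by (intro prefix_length_prefix[OF ET]) auto
        then have "prefix (z @ [x]) X'" unfolding XT z by simp
        then show False using X' xn by (auto simp: prefix_def)
      qed
    qed
    have "prefix (X (k0 + Suc j)) (concat (map f (X (k0 + j))))" if "j < state_count L" for j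
      using Xstep[of 1 "k0 + j"] that Tb hb by (simp add: iter_1)
    moreover have "prefix (pre e (k0 + Suc j) A @ [x]) (concat (map f (pre e (k0 + j) A @ [x])))" for j
      using prefix_pre_image[OF x(1,3), of "k0 + j" A] by simp
    ultimately show ?thesis
      using bounded_residual_not_dead[of L "\<lambda>j. X (k0 + j)" "\<lambda>j. pre e (k0 + j) A @ [x]" i] res
      by auto
  qed
  from dead_either[OF dead_pre[OF x(1,3) dx] Xp prefix_order.refl, of k0] show False
    using * by blast
qed

section \<open>A uniform bound for all words\<close>

definition death_bound :: nat where
  "death_bound = 3 * W + linear_bound + heavy_bound"

lemma stable_letter_dead:
  assumes x: "f x \<noteq> [x]" "f x = e @ x # g" "const_word g" and d: "dead n U (A @ [x])"
  shows "dead (2 * W + linear_bound + heavy_bound) U (A @ [x])"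
proof (cases "const_word e")
  case False
  then show ?thesis using heavy_dead[OF x(2) False x(3) d] by (auto intro: dead_mono)
next
  case True
  from linear_dead_or_reduce[OF x(1,2) True x(3) d] show ?thesis
  proof (elim disjE exE conjE)
    assume "dead linear_bound U (A @ [x])"
    then show ?thesis by (rule dead_mono) simp
  next
    fix Q z e' g'
    assume z: "f z = e' @ z # g'" "\<not> const_word e'" "const_word g'" and p: "prefix (Q @ [z]) (iter W A)"
      and red: "\<forall>t. dead t (iter W U) (Q @ [z]) \<longrightarrow> dead (t + 2 * W) U (A @ [x])"
    have "dead n (iter W U) (iter W A)" using dead_left[OF d] by (rule dead_later)
    then have "dead n (iter W U) (Q @ [z])" using p by (rule dead_prefix_left)
    then have "dead heavy_bound (iter W U) (Q @ [z])" by (rule heavy_dead[OF z])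
    with red have "dead (heavy_bound + 2 * W) U (A @ [x])" by blast
    then show ?thesis by (rule dead_mono) simp
  qed
qed

text \<open>After \<open>W\<close> steps the last non-constant letter has stabilised, and the
  constants behind it are absorbed for free.\<close>

theorem dead_bounded:
  assumes "dead n U V" shows "dead death_bound U V"
proof (cases "const_word V")
  case False
  then obtain A x c where V: "V = A @ x # c" "const_word c" "f x \<noteq> [x]" using last_nonconst by blast
  obtain r z c' s h where z: "iter W [x] = r @ z # c'" "const_word c'" "f z \<noteq> [z]" "f z = s @ z # h" "const_word h"
    using iter_last_nonconst[OF V(3)] by metis
  have WV: "iter W V = ((iter W A @ r) @ [z]) @ c' @ c"
  proof -
    have "iter W V = iter W (A @ [x] @ c)" using V(1) by simp
    then show ?thesis using V(2) z(1) by (simp only: iter_append iter_const_word) simp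
  qed
  have "dead n (iter W U) ((iter W A @ r) @ [z])"
    using dead_later[OF assms, of W] unfolding WV by (rule dead_left)
  then have "dead (2 * W + linear_bound + heavy_bound) (iter W U) ((iter W A @ r) @ [z])"
    by (rule stable_letter_dead[OF z(3-5)])
  then have "dead (2 * W + linear_bound + heavy_bound) (iter W U) (iter W V)"
    unfolding WV by (rule dead_append_const_word) (use V z in simp)
  then show ?thesis by (simp add: dead_iter death_bound_def algebra_simps)
qed (rule dead_const_word)

end

section \<open>Stabilisation of the extremal non-constant letters\<close>

abbreviation subst :: "('a \<Rightarrow> 'a list) \<Rightarrow> 'a list \<Rightarrow> 'a list" where
  "subst f w \<equiv> concat (map f w)"

text \<open>\<open>Supp\<close> for a bare substitution, so that it serves both the images of the
  letters and their reversals.\<close>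

definition reach :: "('a \<Rightarrow> 'a list) \<Rightarrow> 'a \<Rightarrow> 'a set" where
  "reach f x = {y. \<exists>j. y \<in> set ((subst f ^^ j) [x])}"

lemma subst_funpow_append: "(subst f ^^ k) (u @ w) = (subst f ^^ k) u @ (subst f ^^ k) w"
  by (induction k) auto

lemma subst_funpow_const: "(\<forall>z\<in>set w. f z = [z]) \<Longrightarrow> (subst f ^^ k) w = w"
proof (induction k)
  case (Suc k)
  have "subst f w = w" using Suc.prems by (induction w) auto
  with Suc show ?case by simp
qed simp

lemma reach_mono:
  assumes "y \<in> set (f x)" shows "reach f y \<subseteq> reach f x"
proof
  fix z assume "z \<in> reach f y"
  then obtain j where j: "z \<in> set ((subst f ^^ j) [y])" by (auto simp: reach_def)
  obtain u w where "f x = u @ [y] @ w" using assms by (auto dest: split_list)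
  then have "(subst f ^^ Suc j) [x] = (subst f ^^ j) (u @ [y] @ w)" by (simp add: funpow_Suc_right del: funpow.simps)
  then have "z \<in> set ((subst f ^^ Suc j) [x])" using j by (simp only: subst_funpow_append set_append Un_iff) simp
  then show "z \<in> reach f x" unfolding reach_def by blast
qed

lemma self_in_reach: "x \<in> reach f x"
  unfolding reach_def by (auto intro: exI[of _ 0])

text \<open>Let \<open>F\<close> take a letter to the first non-constant letter of its image. Along
  its orbit \<open>reach\<close> can only shrink. If two steps leave it unchanged, both letters met
  lie in the stratum of \<open>x\<close>, and the hypothesis on \<open>find\<close> makes them
  equal: a fixed point of \<open>F\<close>. Otherwise induct on the size of
  \<open>reach\<close>.\<close>

lemma first_nonconst_stable:
  fixes f :: "'a::finite \<Rightarrow> 'a list"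
  assumes self: "\<And>x. x \<in> set (f x)"
    and find: "\<And>x. find (\<lambda>y. y \<in> {y \<in> reach f x. reach f y = reach f x}) (subst f (f x)) =
                   find (\<lambda>y. y \<in> {y \<in> reach f x. reach f y = reach f x}) (f x)"
  shows "\<exists>W0. \<forall>W\<ge>W0. \<forall>x. f x \<noteq> [x] \<longrightarrow>
    (\<exists>c y r. (subst f ^^ W) [x] = c @ y # r \<and> (\<forall>z\<in>set c. f z = [z]) \<and>
        f y \<noteq> [y] \<and> (\<exists>e s. f y = e @ y # s \<and> (\<forall>z\<in>set e. f z = [z])))"
proof -
  let ?nc = "\<lambda>x. f x \<noteq> [x]"
  have "\<forall>x. \<exists>y. ?nc x \<longrightarrow> ?nc y \<and> (\<exists>c r. f x = c @ y # r \<and> (\<forall>z\<in>set c. f z = [z]))"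
  proof
    fix x
    show "\<exists>y. ?nc x \<longrightarrow> ?nc y \<and> (\<exists>c r. f x = c @ y # r \<and> (\<forall>z\<in>set c. f z = [z]))"
    proof (cases "?nc x")
      case True
      then have "\<exists>z\<in>set (f x). ?nc z" using self by blast
      from split_list_first_prop[OF this] show ?thesis by auto
    qed simp
  qed
  from choice[OF this] obtain F where
    F0: "\<forall>x. ?nc x \<longrightarrow> ?nc (F x) \<and> (\<exists>c r. f x = c @ F x # r \<and> (\<forall>z\<in>set c. f z = [z]))" ..
  then have F: "?nc (F x)" "\<exists>c r. f x = c @ F x # r \<and> (\<forall>z\<in>set c. f z = [z])" if "?nc x" for x
    using that by simp_all
  have Fr: "reach f (F x) \<subseteq> reach f x" if x: "?nc x" for x
  proof (rule reach_mono)
    obtain c r where "f x = c @ F x # r" using F(2)[OF x] by blast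
    then show "F x \<in> set (f x)" by (simp only: set_append list.set) simp
  qed
  \<comment> \<open>A constant letter reaches only itself, so \<open>find\<close> skips it when
    searching the stratum of a non-constant letter.\<close>
  have const: "z \<notin> {y \<in> reach f x. reach f y = reach f x}" if "?nc x" "f z = [z]" for x z
  proof
    assume "z \<in> {y \<in> reach f x. reach f y = reach f x}"
    then have "reach f z = reach f x" by simp
    then have "x \<in> reach f z" using self_in_reach[of x f] by simp
    then obtain j where "x \<in> set ((subst f ^^ j) [z])" unfolding reach_def by blast
    moreover have "(subst f ^^ j) [z] = [z]" using that(2) by (intro subst_funpow_const) simp
    ultimately have "x = z" by (simp only: list.set) simp
    with that show False by blast
  qed
  have skip: "find P (c @ w) = find P w" if "\<forall>z\<in>set c. \<not> P z" for P and c w :: "'a list"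
    using that by (induction c) auto
  have ev: "\<exists>n. F ((F ^^ n) x) = (F ^^ n) x" if "?nc x" for x
    using that
  proof (induction "card (reach f x)" arbitrary: x rule: less_induct)
    case less
    define y where "y = F x"
    define z where "z = F y"
    have nc: "?nc y" "?nc z" using F(1) less.prems by (auto simp: y_def z_def)
    have sub: "reach f y \<subseteq> reach f x" "reach f z \<subseteq> reach f x"
      using Fr[OF less.prems] Fr[OF nc(1)] by (auto simp: y_def z_def)
    show ?case
    proof (cases "reach f y = reach f x \<and> reach f z = reach f x")
      case True
      let ?S = "{y \<in> reach f x. reach f y = reach f x}"
      have in_S: "y \<in> ?S" "z \<in> ?S" using True self_in_reach[of y f] self_in_reach[of z f] by auto
      obtain c r where c: "f x = c @ y # r" "\<forall>z\<in>set c. f z = [z]"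
        using F(2)[OF less.prems] by (auto simp: y_def)
      obtain d s where d: "f y = d @ z # s" "\<forall>z\<in>set d. f z = [z]"
        using F(2)[OF nc(1)] by (auto simp: z_def)
      have cS: "\<forall>z\<in>set c. z \<notin> ?S" and dS: "\<forall>z\<in>set d. z \<notin> ?S"
        using const[OF less.prems] c(2) d(2) by blast+
      have "find (\<lambda>y. y \<in> ?S) (f x) = Some y"
        unfolding c(1) skip[OF cS] using in_S by simp
      moreover have "subst f c = c" using subst_funpow_const[OF c(2), of 1] by simp
      then have "subst f (f x) = c @ d @ z # (s @ subst f r)" by (simp add: c(1) d(1))
      then have "find (\<lambda>y. y \<in> ?S) (subst f (f x)) = Some z"
        using in_S by (simp only: skip[OF cS] skip[OF dS]) simp
      ultimately have "y = z" using find[of x] by simp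
      then show ?thesis by (intro exI[of _ 1]) (simp add: y_def z_def)
    next
      case False
      then consider "card (reach f y) < card (reach f x)" | "card (reach f z) < card (reach f x)"
        using sub psubset_card_mono[of "reach f x"] by (metis finite psubsetI)
      then show ?thesis
      proof cases
        case 1
        then obtain n where "F ((F ^^ n) y) = (F ^^ n) y" using less.hyps nc by blast
        then show ?thesis by (intro exI[of _ "Suc n"]) (simp add: y_def funpow_swap1)
      next
        case 2
        then obtain n where "F ((F ^^ n) z) = (F ^^ n) z" using less.hyps nc by blast
        then show ?thesis
          by (intro exI[of _ "Suc (Suc n)"]) (simp add: y_def z_def funpow_swap1)
      qed
    qed
  qed
  then have "\<forall>x. \<exists>n. ?nc x \<longrightarrow> F ((F ^^ n) x) = (F ^^ n) x" by blast
  from choice[OF this] obtain N where "\<forall>x. ?nc x \<longrightarrow> F ((F ^^ N x) x) = (F ^^ N x) x" ..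
  then have N: "F ((F ^^ N x) x) = (F ^^ N x) x" if "?nc x" for x using that by simp
  have iter: "?nc ((F ^^ n) x) \<and> (\<exists>c r. (subst f ^^ n) [x] = c @ (F ^^ n) x # r \<and> (\<forall>z\<in>set c. f z = [z]))"
    if "?nc x" for n x
  proof (induction n)
    case (Suc n)
    then obtain c r where c: "(subst f ^^ n) [x] = c @ (F ^^ n) x # r" "\<forall>z\<in>set c. f z = [z]"
      "?nc ((F ^^ n) x)" by blast
    obtain d s where d: "f ((F ^^ n) x) = d @ F ((F ^^ n) x) # s" "\<forall>z\<in>set d. f z = [z]"
      using F(2)[OF c(3)] by blast
    have "subst f c = c" using subst_funpow_const[OF c(2), of 1] by simp
    then have "(subst f ^^ Suc n) [x] = (c @ d) @ (F ^^ Suc n) x # (s @ subst f r)"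
      by (simp add: c(1)) (simp add: d(1))
    moreover have "\<forall>z\<in>set (c @ d). f z = [z]" using c(2) d(2) by auto
    moreover have "?nc ((F ^^ Suc n) x)" using F(1)[OF c(3)] by simp
    ultimately show ?case by blast
  qed (use that in \<open>auto intro!: exI[of _ "[]"]\<close>)
  show ?thesis
  proof (intro exI[of _ "Max (range N)"] allI impI)
    fix W x assume W: "Max (range N) \<le> W" and x: "?nc x"
    have "N x \<le> Max (range N)" by (intro Max_ge) auto
    then obtain m where m: "W = m + N x" using W by (metis le_add_diff_inverse2 order_trans)
    have "F ((F ^^ (m + N x)) x) = (F ^^ (m + N x)) x"
      using N[OF x] by (induction m) (auto simp: funpow_add)
    then have fix_y: "F ((F ^^ W) x) = (F ^^ W) x" by (simp add: m)
    obtain c r where c: "(subst f ^^ W) [x] = c @ (F ^^ W) x # r" "\<forall>z\<in>set c. f z = [z]"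
      "?nc ((F ^^ W) x)" using iter[OF x] by blast
    then show "\<exists>c y r. (subst f ^^ W) [x] = c @ y # r \<and> (\<forall>z\<in>set c. f z = [z]) \<and>
        f y \<noteq> [y] \<and> (\<exists>e s. f y = e @ y # s \<and> (\<forall>z\<in>set e. f z = [z]))"
      using F(2)[OF c(3)] unfolding fix_y by blast
  qed
qed

section \<open>Positive words in the free group\<close>

definition pos :: "'a list \<Rightarrow> 'a fword" where
  "pos w = map (\<lambda>x. (x, True)) w"

text \<open>The reversals turn the cancellation between the two factors into the removal of a common
  prefix.\<close>

definition quot :: "'a list \<Rightarrow> 'a list \<Rightarrow> 'a fword" where
  "quot X Y = pos (rev X) \<otimes>\<^bsub>free_group\<^esub> inv\<^bsub>free_group\<^esub> pos (rev Y)"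

interpretation free_group: group "free_group :: 'a fword monoid"
  by (rule group_free_group)

lemma positive_word_iff: "positive_word w \<longleftrightarrow> w = pos (letters w)"
  unfolding positive_word_def pos_def letters_def by (induction w) (auto simp: prod_eq_iff)

lemma letters_pos [simp]: "letters (pos w) = w"
  by (simp add: letters_def pos_def comp_def)

lemma reduced_pos [simp]: "reduced (pos w)"
  unfolding pos_def reduced_def by (induction w rule: induct_list012) (auto simp: flip_def)

lemma pos_carrier [simp]: "pos w \<in> carrier free_group"
  by (simp add: free_group_def)

lemma pos_mult: "pos u \<otimes>\<^bsub>free_group\<^esub> pos v = pos (u @ v)"
  using free_reduce_reduced[OF reduced_pos[of "u @ v"]] by (simp add: free_group_def pos_def)

lemma quot_apart:
  assumes "apart X Y"
  shows "quot X Y = pos (rev X) @ map (\<lambda>x. (x, False)) Y"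
proof -
  have inv: "rev (map flip (pos (rev Y))) = map (\<lambda>x. (x, False)) Y"
    by (simp add: pos_def flip_def rev_map comp_def)
  have "reduced (rev (map flip (pos (rev Y))))" by (rule reduced_rev_flip) simp
  then have "reduced (pos (rev X) @ map (\<lambda>x. (x, False)) Y)"
    unfolding inv using reduced_pos[of "rev X"] assms
    by (cases X; cases Y) (auto simp: reduced_def successively_append_iff apart_def pos_def flip_def)
  then show ?thesis
    by (simp add: quot_def inv_free_group inv) (simp add: free_group_def free_reduce_reduced)
qed

lemma quot_cancel: "quot (p @ X) (p @ Y) = quot X Y"
proof -
  have "quot (p @ X) (p @ Y) = (pos (rev X) \<otimes>\<^bsub>free_group\<^esub> pos (rev p)) \<otimes>\<^bsub>free_group\<^esub>
      inv\<^bsub>free_group\<^esub> (pos (rev Y) \<otimes>\<^bsub>free_group\<^esub> pos (rev p))"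
    by (simp add: quot_def pos_mult)
  also have "\<dots> = quot X Y"
    by (simp add: quot_def free_group.inv_mult_group free_group.m_assoc)
      (simp add: free_group.r_inv free_group.m_assoc[symmetric])
  finally show ?thesis .
qed

lemma quot_negative_letters:
  "(\<forall>x. (x, False) \<in> set (quot X Y) \<longrightarrow> P x) \<longleftrightarrow> (\<exists>p r. prefix p X \<and> Y = p @ r \<and> (\<forall>x\<in>set r. P x))"
proof -
  obtain p X' Y' where d: "X = p @ X'" "Y = p @ Y'" "apart X' Y'" by (rule apart_decomposition)
  have "(\<forall>x. (x, False) \<in> set (quot X Y) \<longrightarrow> P x) \<longleftrightarrow> (\<forall>x\<in>set Y'. P x)"
    by (auto simp: d quot_cancel quot_apart pos_def)
  also have "\<dots> \<longleftrightarrow> (\<exists>p r. prefix p X \<and> Y = p @ r \<and> (\<forall>x\<in>set r. P x))"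
  proof
    assume "\<exists>p r. prefix p X \<and> Y = p @ r \<and> (\<forall>x\<in>set r. P x)"
    then obtain q r where q: "prefix q X" "Y = q @ r" "\<forall>x\<in>set r. P x" by blast
    have "prefix q p" by (rule apart_common_prefix[OF d(3)]) (use q d in auto)
    then obtain z where "p = q @ z" by (auto simp: prefix_def)
    then have "r = z @ Y'" using q(2) d(2) by simp
    with q(3) show "\<forall>x\<in>set Y'. P x" by auto
  next
    assume "\<forall>x\<in>set Y'. P x"
    moreover have "prefix p X" using d(1) by simp
    ultimately show "\<exists>p r. prefix p X \<and> Y = p @ r \<and> (\<forall>x\<in>set r. P x)" using d(2) by blast
  qed
  finally show ?thesis .
qed

text \<open>The positive letters of the reduced quotient spell the reversal of \<open>X\<close>, the
  negative ones spell \<open>Y\<close>.\<close>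

lemma quot_inj:
  assumes "apart X Y" "apart X' Y'" "quot X Y = quot X' Y'"
  shows "X = X'" "Y = Y'"
proof -
  have eq: "pos (rev X) @ map (\<lambda>x. (x, False)) Y = pos (rev X') @ map (\<lambda>x. (x, False)) Y'"
    using assms by (simp add: quot_apart)
  from arg_cong[OF eq, of "\<lambda>w. map fst (filter snd w)"]
  show "X = X'" by (simp add: pos_def filter_map comp_def)
  from arg_cong[OF eq, of "\<lambda>w. map fst (filter (\<lambda>l. \<not> snd l) w)"]
  show "Y = Y'" by (simp add: pos_def filter_map comp_def)
qed

text \<open>Both words extend to a common word, so the quotient is determined by the overhangs
  \<open>r\<close> and \<open>s\<close> alone.\<close>

lemma quot_common_multiple:
  assumes "X @ r = Y @ s"
  shows "quot X Y = inv\<^bsub>free_group\<^esub> pos (rev r) \<otimes>\<^bsub>free_group\<^esub> pos (rev s)"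
proof -
  have "pos (rev r) \<otimes>\<^bsub>free_group\<^esub> pos (rev X) = pos (rev s) \<otimes>\<^bsub>free_group\<^esub> pos (rev Y)"
    using assms by (simp add: pos_mult flip: rev_append)
  then have "pos (rev X) = inv\<^bsub>free_group\<^esub> pos (rev r) \<otimes>\<^bsub>free_group\<^esub> (pos (rev s) \<otimes>\<^bsub>free_group\<^esub> pos (rev Y))"
    by (metis free_group.inv_solve_left free_group.m_closed pos_carrier)
  then show ?thesis
    by (simp add: quot_def free_group.m_assoc free_group.r_inv)
qed

lemma prefix_subst_split:
  assumes "prefix p (subst f X)" "\<And>x. length (f x) \<le> K"
  shows "\<exists>X1 r. prefix X1 X \<and> p = subst f X1 @ r \<and> length r \<le> K"
  using assms(1)
proof (induction X arbitrary: p)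
  case (Cons x X)
  show ?case
  proof (cases "prefix p (f x)")
    case True
    then have "length p \<le> K" using assms(2)[of x] prefix_length_le order_trans by blast
    then show ?thesis by (intro exI[of _ "[]"] exI[of _ p]) auto
  next
    case False
    then obtain q where q: "p = f x @ q" "prefix q (subst f X)"
      using Cons.prems by (auto simp: prefix_append)
    then obtain X1 r where "prefix X1 X" "q = subst f X1 @ r" "length r \<le> K" using Cons.IH by blast
    then show ?thesis using q by (intro exI[of _ "x # X1"] exI[of _ r]) auto
  qed
qed auto

section \<open>The substitution induced by a positive automorphism\<close>

locale positive_automorphism =
  fixes \<phi> :: "'a::finite fword \<Rightarrow> 'a fword"
  assumes iso: "\<phi> \<in> iso free_group free_group"
    and positive: "positive_endo \<phi>"
begin

definition im :: "'a \<Rightarrow> 'a list" where "im x = letters (\<phi> (gen x))"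

definition rim :: "'a \<Rightarrow> 'a list" where "rim x = rev (im x)"

sublocale hom: group_hom free_group free_group \<phi>
  using iso by unfold_locales (auto simp: iso_def)

lemma image_gen: "\<phi> (pos [x]) = pos (im x)"
  using positive by (simp add: positive_endo_def positive_word_iff im_def pos_def gen_def)

lemma image_pos: "\<phi> (pos w) = pos (subst im w)"
proof (induction w)
  case Nil
  have "\<one>\<^bsub>free_group\<^esub> = pos []" by (simp add: free_group_def pos_def)
  then show ?case using hom.hom_one by (metis concat.simps(1) list.map(1))
next
  case (Cons x w)
  have "\<phi> (pos (x # w)) = \<phi> (pos [x] \<otimes>\<^bsub>free_group\<^esub> pos w)" by (simp add: pos_mult)
  also have "\<dots> = pos (im x) \<otimes>\<^bsub>free_group\<^esub> pos (subst im w)"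
    by (simp only: hom.hom_mult[OF pos_carrier pos_carrier] image_gen Cons)
  finally show ?case by (simp add: pos_mult)
qed

lemma funpow_pos: "(\<phi> ^^ k) (pos w) = pos ((subst im ^^ k) w)"
  by (induction k) (auto simp: image_pos)

lemma subst_rim: "subst rim (rev w) = rev (subst im w)"
  by (induction w) (auto simp: rim_def)

lemma funpow_rim: "(subst rim ^^ k) (rev w) = rev ((subst im ^^ k) w)"
  by (induction k) (auto simp: subst_rim)

lemma image_quot: "\<phi> (quot X Y) = quot (subst rim X) (subst rim Y)"
  using subst_rim[of "rev X"] subst_rim[of "rev Y"]
  by (simp add: quot_def image_pos)

lemma funpow_quot: "(\<phi> ^^ k) (quot X Y) = quot ((subst rim ^^ k) X) ((subst rim ^^ k) Y)"
  by (induction k) (auto simp: image_quot)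

lemma constant_letter_iff: "constant_letter \<phi> x \<longleftrightarrow> rim x = [x]"
proof -
  have "\<phi> (gen x) = pos (im x)" "gen x = pos [x]" using image_gen[of x] by (auto simp: gen_def pos_def)
  then have "constant_letter \<phi> x \<longleftrightarrow> im x = [x]"
    unfolding constant_letter_def by (metis letters_pos)
  then show ?thesis by (auto simp: rim_def)
qed

text \<open>If the images of \<open>X\<close> and \<open>Y\<close> agree up to overhangs of length
  at most \<open>K\<close>, then \<phi> maps their quotient to one of finitely many elements.
  Injectivity of \<phi> and \<open>quot_inj\<close> leave finitely many such pairs. Cutting a common
  prefix after its last complete letter image on either side yields such a pair.\<close>

lemma bounded_common_prefix:
  "\<exists>B. \<forall>X Y p. apart X Y \<longrightarrow> prefix p (subst rim X) \<longrightarrow> prefix p (subst rim Y) \<longrightarrow> length p \<le> B"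
proof -
  define K where "K = Max (range (\<lambda>x. length (rim x)))"
  have K: "length (rim x) \<le> K" for x unfolding K_def by (intro Max_ge) auto
  define S where "S = {w :: 'a list. length w \<le> K}"
  have "finite S" using finite_lists_length_le[of "UNIV :: 'a set" K] by (simp add: S_def)
  define Z where "Z = {(X, Y). apart X Y \<and> (\<exists>r\<in>S. \<exists>s\<in>S. subst rim X @ r = subst rim Y @ s)}"
  have "inj_on (\<lambda>(X, Y). \<phi> (quot X Y)) Z"
  proof (rule inj_onI)
    fix a b assume ab: "a \<in> Z" "b \<in> Z" "(\<lambda>(X, Y). \<phi> (quot X Y)) a = (\<lambda>(X, Y). \<phi> (quot X Y)) b"
    obtain X Y X' Y' where eq: "a = (X, Y)" "b = (X', Y')" by fastforce
    have "quot X Y \<in> carrier free_group" "quot X' Y' \<in> carrier free_group"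
      by (simp_all add: quot_def)
    moreover have "inj_on \<phi> (carrier free_group)" using iso by (simp add: iso_def bij_betw_def)
    ultimately have "quot X Y = quot X' Y'" using ab(3) eq by (auto dest: inj_onD)
    then show "a = b" using quot_inj ab(1,2) eq by (auto simp: Z_def)
  qed
  moreover have "(\<lambda>(X, Y). \<phi> (quot X Y)) ` Z \<subseteq>
      (\<lambda>(r, s). inv\<^bsub>free_group\<^esub> pos (rev r) \<otimes>\<^bsub>free_group\<^esub> pos (rev s)) ` (S \<times> S)"
    by (force simp: Z_def image_quot quot_common_multiple)
  ultimately have "finite Z"
    using \<open>finite S\<close> by (meson finite_SigmaI finite_imageD finite_imageI finite_subset)
  then have "finite ((\<lambda>(X, Y). length (subst rim X)) ` Z)" by simp
  then obtain M where M: "\<forall>n\<in>(\<lambda>(X, Y). length (subst rim X)) ` Z. n \<le> M"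
    by (auto simp only: finite_nat_set_iff_bounded_le)
  show ?thesis
  proof (intro exI[of _ "M + K"] allI impI)
    fix X Y p assume a: "apart X Y" "prefix p (subst rim X)" "prefix p (subst rim Y)"
    obtain X1 r where X1: "prefix X1 X" "p = subst rim X1 @ r" "length r \<le> K"
      using prefix_subst_split[OF a(2) K] by blast
    obtain Y1 s where Y1: "prefix Y1 Y" "p = subst rim Y1 @ s" "length s \<le> K"
      using prefix_subst_split[OF a(3) K] by blast
    have "apart X1 Y1" using a(1) X1(1) Y1(1) by (auto simp: apart_def prefix_def)
    then have "(X1, Y1) \<in> Z" using X1 Y1 unfolding Z_def S_def by blast
    then have "length (subst rim X1) \<le> M" using M by force
    then show "length p \<le> M + K" using X1 by simp
  qed
qed

lemma neuters_within_iff: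
  "neuters_within \<phi> (pos (rev X)) (pos (rev Y)) k \<longleftrightarrow> k > 0 \<and>
    (\<exists>p r. prefix p ((subst rim ^^ k) X) \<and> (subst rim ^^ k) Y = p @ r \<and> (\<forall>x\<in>set r. rim x = [x]))"
proof -
  have "positive_word (pos w)" for w :: "'a list" by (simp add: positive_word_def pos_def)
  then show ?thesis
    unfolding neuters_within_def constant_letter_iff quot_def[symmetric] funpow_quot
      quot_negative_letters by simp
qed

lemma letters_funpow: "letters ((\<phi> ^^ j) (gen x)) = (subst im ^^ j) [x]"
  using funpow_pos[of j "[x]"] by (simp add: gen_def pos_def letters_def comp_def)

lemma reach_im: "reach im x = Supp \<phi> x"
  by (simp add: reach_def Supp_def letters_funpow)

lemma reach_rim: "reach rim x = Supp \<phi> x"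
  using funpow_rim[of _ "[x]"] by (simp add: reach_def Supp_def letters_funpow)

lemma stratum_reach: "{y \<in> Supp \<phi> x. Supp \<phi> y = Supp \<phi> x} = stratum \<phi> x"
  by (simp add: stratum_def)

end

section \<open>Neutering in the free group as death of words\<close>

theorem proposition1p8p4:
  fixes \<phi> :: "'a::finite fword \<Rightarrow> 'a fword"
  assumes "\<phi> \<in> iso free_group free_group"
    and "positive_endo \<phi>"
    and "conditioned \<phi>"
  shows "\<exists>T\<^sub>0::nat. \<forall>U V. positive_word U \<longrightarrow> positive_word V \<longrightarrow>
           neuters \<phi> U V \<longrightarrow> neuters_within \<phi> U V T\<^sub>0"
proof -
  interpret positive_automorphism \<phi> using assms by unfold_locales
  have self: "x \<in> set (im x)" for x using assms(3) by (simp add: conditioned_def im_def)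
  \<comment> \<open>The condition on extremal letters of strata, taken at \<open>j = 2\<close> for
    the stratum of \<open>x\<close> itself.\<close>
  have extremal: "find (\<lambda>y. y \<in> stratum \<phi> x) (subst im (im x)) = find (\<lambda>y. y \<in> stratum \<phi> x) (im x) \<and>
      find (\<lambda>y. y \<in> stratum \<phi> x) (subst rim (rim x)) = find (\<lambda>y. y \<in> stratum \<phi> x) (rim x)" for x
  proof -
    have "stratum \<phi> x \<subseteq> Supp \<phi> x" by (auto simp: stratum_def)
    then have "leftmost_in (stratum \<phi> x) ((\<phi> ^^ 2) (gen x)) = leftmost_in (stratum \<phi> x) (\<phi> (gen x)) \<and>
        rightmost_in (stratum \<phi> x) ((\<phi> ^^ 2) (gen x)) = rightmost_in (stratum \<phi> x) (\<phi> (gen x))"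
      using assms(3) unfolding conditioned_def by (meson one_le_numeral rangeI)
    moreover have "letters ((\<phi> ^^ 2) (gen x)) = subst im (im x)"
      unfolding letters_funpow by (simp add: numeral_2_eq_2)
    ultimately show ?thesis
      using subst_rim[of "im x"] by (simp add: leftmost_in_def rightmost_in_def rim_def im_def)
  qed
  obtain W1 where W1: "\<forall>W\<ge>W1. \<forall>x. im x \<noteq> [x] \<longrightarrow>
    (\<exists>c y r. (subst im ^^ W) [x] = c @ y # r \<and> (\<forall>z\<in>set c. im z = [z]) \<and>
        im y \<noteq> [y] \<and> (\<exists>e s. im y = e @ y # s \<and> (\<forall>z\<in>set e. im z = [z])))"
    using first_nonconst_stable[of im] self extremal unfolding reach_im stratum_reach by auto
  obtain W2 where W2: "\<forall>W\<ge>W2. \<forall>x. rim x \<noteq> [x] \<longrightarrow>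
    (\<exists>c y r. (subst rim ^^ W) [x] = c @ y # r \<and> (\<forall>z\<in>set c. rim z = [z]) \<and>
        rim y \<noteq> [y] \<and> (\<exists>e s. rim y = e @ y # s \<and> (\<forall>z\<in>set e. rim z = [z])))"
    using first_nonconst_stable[of rim] self extremal unfolding reach_rim stratum_reach
    by (auto simp: rim_def)
  obtain B where B: "\<And>X Y p. apart X Y \<Longrightarrow> prefix p (subst rim X) \<Longrightarrow> prefix p (subst rim Y) \<Longrightarrow> length p \<le> B"
    using bounded_common_prefix by blast
  have rim_const: "rim z = [z] \<longleftrightarrow> im z = [z]" for z by (auto simp: rim_def)
  interpret word_substitution rim B "max W1 W2"
  proof
    show "x \<in> set (rim x)" for x using self by (simp add: rim_def)
    show "length p \<le> B" if "apart X Y" "prefix p (subst rim X)" "prefix p (subst rim Y)" for X Y p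
      using B that by blast
  next
    fix x assume "rim x \<noteq> [x]"
    then show "\<exists>c y r. (subst rim ^^ max W1 W2) [x] = c @ y # r \<and> (\<forall>z\<in>set c. rim z = [z]) \<and>
        rim y \<noteq> [y] \<and> (\<exists>e s. rim y = e @ y # s \<and> (\<forall>z\<in>set e. rim z = [z]))"
      using W2 by simp
  next
    fix x assume "rim x \<noteq> [x]"
    \<comment> \<open>The last non-constant letter of a reversed image is the first one of the image
      itself.\<close>
    then obtain c y r e s where c: "(subst im ^^ max W1 W2) [x] = c @ y # r" "\<forall>z\<in>set c. im z = [z]"
      "im y \<noteq> [y]" "im y = e @ y # s" "\<forall>z\<in>set e. im z = [z]"
      using W1 rim_const by (metis max.cobounded1)
    have "(subst rim ^^ max W1 W2) [x] = rev r @ y # rev c"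
      using funpow_rim[of "max W1 W2" "[x]"] c(1) by simp
    moreover have "rim y = rev s @ y # rev e" using c(4) by (simp add: rim_def)
    ultimately show "\<exists>c y r. (subst rim ^^ max W1 W2) [x] = r @ y # c \<and> (\<forall>z\<in>set c. rim z = [z]) \<and>
        rim y \<noteq> [y] \<and> (\<exists>e s. rim y = s @ y # e \<and> (\<forall>z\<in>set e. rim z = [z]))"
      using c(2,3,5) rim_const by (metis set_rev)
  qed
  have iff: "neuters_within \<phi> (pos (rev X)) (pos (rev Y)) k \<longleftrightarrow> k > 0 \<and> dead k X Y" for X Y k
    unfolding neuters_within_iff dead_def absorbs_def iter_def const_word_def by simp
  show ?thesis
  \<comment> \<open>The successor makes the number of steps positive, as
    \<open>neuters_within\<close> demands.\<close>
  proof (intro exI[of _ "Suc death_bound"] allI impI)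
    fix U V assume pos: "positive_word U" "positive_word V" and "neuters \<phi> U V"
    define X Y where "X = rev (letters U)" and "Y = rev (letters V)"
    have UV: "U = pos (rev X)" "V = pos (rev Y)" using pos by (simp_all add: positive_word_iff X_def Y_def)
    obtain k where "neuters_within \<phi> U V k" using \<open>neuters \<phi> U V\<close> by (auto simp: neuters_def)
    then have "dead k X Y" by (simp add: UV iff)
    then have "dead (Suc death_bound) X Y" by (intro dead_Suc dead_bounded)
    then show "neuters_within \<phi> U V (Suc death_bound)" by (simp add: UV iff)
  qed
qed

end
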